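(* Let $R$ be a flat $A$-algebra. Then $\varphi_{0,R}(\tilde T(R))\subseteq\tilde H(R)$. Consequently the morphism $\tilde T\to H^0$, $X\mapsto h\circ X$, factors through $\tilde H$.
   Context: $F$ is a non-Archimedean local field with ring of integers $A$ and residue characteristic $p$. $(K,\sigma)$ is one of: $K=F$ with $\mathrm{char}\,F\neq2$, $\sigma=\mathrm{id}$; $K=E$ a separable quadratic extension with nontrivial automorphism $\sigma$; $K=F\oplus F$, $\sigma(x,y)=(y,x)$; $K=D$ the quaternion division algebra with standard involution. $B$ is the maximal $A$-order of $K$; $\epsilon\in\{\pm1\}$. If $(K,\epsilon,p)\ne(F,1,2)$, $L$ is a free right $B$-module of rank $n$ with a $(\sigma,\epsilon)$-hermitian form $h:L\times L\to B$ and "hermitian form" means such a form; if $(K,\epsilon,p)=(F,1,2)$, $L$ is a free $A$-module of rank $n$ with quadratic form $h$, $h(v,w)=\frac12(h(v+w)-h(v)-h(w))$, and "hermitian form" means quadratic form (conditions/formulas via the associated bilinear form). $V=L\otimes_AF$ is nondegenerate; $L^{\#}=\{x\in V:h(x,L)\subset B\}$ and $(L^{\#})^{\#}=L$ is assumed. Adjoint $X^{ad}$: $h(X(v),w)=h(v,X^{ad}(w))$. For a flat $A$-algebra $R$: $T^0(R)=\{X\in\mathrm{End}_{B\otimes R}(L\otimes R):X(L^{\#}\otimes R)\subset L^{\#}\otimes R\}$; $H^0(R)$ = hermitian forms $f$ on $L\otimes R$ with $f(L\otimes R,L^{\#}\otimes R)\subset B\otimes R$; $\varphi_{0,R}(X)=h\circ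 X$ with $(h\circ X)(v,w)=h(X(v),X(w))$; $\psi_{0,R}(X)(v,w)=h(v,X(w))+h(X(v),w)$. Recursively, $\overline{\varphi_{m,A}}:T^m(A)\to H^0(A)/\psi_{0,A}(T^m(A))$ is $\varphi_{0,A}$ followed by the quotient, $T^{m+1}(A)=\{X\in T^m(A):\overline{\varphi_{m,A}}(X)=0=\overline{\varphi_{m,A}}(X^{ad})\}$, and $T^m(R)=R\otimes_AT^m(A)$ for flat $R$. Let $\alpha\ge0$ be the smallest integer with $T^m(A)=T^\alpha(A)$ for all $m\ge\alpha$ (it exists); $\tilde T:=T^\alpha$ and $\tilde H(R):=\psi_{0,R}(\tilde T(R))$ for flat $R$. *)

theory Defs
  imports
    "HOL-Algebra.QuotRing"
    "HOL-Algebra.Module"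
    "HOL-Library.Multiset"
    "HOL-Computational_Algebra.Polynomial"
begin

hide_const (open) Polynomial.smult

section \<open>Non-Archimedean local fields\<close>

text \<open>The valuation is a function into the integers; its value at 0 is irrelevant.\<close>

definition val_ge :: "('f::field \<Rightarrow> int) \<Rightarrow> int \<Rightarrow> 'f set" where
  "val_ge val N = {x. x = 0 \<or> val x \<ge> N}"

definition int_ring :: "('f::field \<Rightarrow> int) \<Rightarrow> 'f ring" where
  "int_ring val =
     \<lparr>carrier = val_ge val 0, monoid.mult = (*), one = 1, ring.zero = 0, add = (+)\<rparr>"

definition nonarch_local_field :: "('f::field \<Rightarrow> int) \<Rightarrow> bool" where
  "nonarch_local_field val \<longleftrightarrow>
     (\<forall>x y. x \<noteq> 0 \<longrightarrow> y \<noteq> 0 \<longrightarrow> val (x * y) = val x + val y) \<and>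
     (\<forall>x y. x \<noteq> 0 \<longrightarrow> y \<noteq> 0 \<longrightarrow> x + y \<noteq> 0 \<longrightarrow> val (x + y) \<ge> min (val x) (val y)) \<and>
     (\<exists>x. x \<noteq> 0 \<and> val x = 1) \<and>
     (\<forall>X :: nat \<Rightarrow> 'f. (\<forall>N. \<exists>M. \<forall>i\<ge>M. \<forall>j\<ge>M. X i - X j \<in> val_ge val N) \<longrightarrow>
        (\<exists>x. \<forall>N. \<exists>M. \<forall>i\<ge>M. X i - x \<in> val_ge val N)) \<and>
     finite (carrier (int_ring val Quot val_ge val 1))"

definition residue_char :: "('f::field \<Rightarrow> int) \<Rightarrow> nat" where
  "residue_char val = (LEAST p. p > 0 \<and> of_nat p \<in> val_ge val 1)"

section \<open>The pairs \<open>(K, \<sigma>)\<close> and maximal orders\<close>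

text \<open>\<open>K\<close> is the type \<open>'k\<close>, an algebra over \<open>F\<close> through the central map \<open>\<iota>\<close>.\<close>

definition algebra_map :: "('f::field \<Rightarrow> 'k::ring_1) \<Rightarrow> bool" where
  "algebra_map \<iota> \<longleftrightarrow> \<iota> 1 = 1 \<and> (\<forall>a b. \<iota> (a + b) = \<iota> a + \<iota> b) \<and>
     (\<forall>a b. \<iota> (a * b) = \<iota> a * \<iota> b) \<and> (\<forall>a x. \<iota> a * x = x * \<iota> a)"

definition dim_over :: "('f::field \<Rightarrow> 'k::ring_1) \<Rightarrow> nat" where
  "dim_over \<iota> = vector_space.dim (\<lambda>a x. \<iota> a * x) UNIV"

definition case_base :: "('f::field \<Rightarrow> 'k::ring_1) \<Rightarrow> ('k \<Rightarrow> 'k) \<Rightarrow> bool" where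
  "case_base \<iota> \<sigma> \<longleftrightarrow> surj \<iota> \<and> (2::'f) \<noteq> 0 \<and> \<sigma> = id"

definition case_quadratic :: "('f::field \<Rightarrow> 'k::ring_1) \<Rightarrow> ('k \<Rightarrow> 'k) \<Rightarrow> bool" where
  "case_quadratic \<iota> \<sigma> \<longleftrightarrow>
     (\<forall>x y :: 'k. x * y = y * x) \<and> (\<forall>x :: 'k. x \<noteq> 0 \<longrightarrow> (\<exists>y. x * y = 1)) \<and>
     dim_over \<iota> = 2 \<and>
     (\<forall>x. \<exists>P :: 'f poly. coprime P (pderiv P) \<and> (\<Sum>i\<le>degree P. \<iota> (coeff P i) * x ^ i) = 0) \<and>
     bij \<sigma> \<and> (\<forall>x y. \<sigma> (x + y) = \<sigma> x + \<sigma> y) \<and> (\<forall>x y. \<sigma> (x * y) = \<sigma> x * \<sigma> y) \<and>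
     (\<forall>a. \<sigma> (\<iota> a) = \<iota> a) \<and> \<sigma> \<noteq> id"

definition case_split :: "('f::field \<Rightarrow> 'k::ring_1) \<Rightarrow> ('k \<Rightarrow> 'k) \<Rightarrow> bool" where
  "case_split \<iota> \<sigma> \<longleftrightarrow> (\<exists>p q :: 'k \<Rightarrow> 'f.
     bij (\<lambda>x. (p x, q x)) \<and>
     (\<forall>x y. p (x + y) = p x + p y \<and> q (x + y) = q x + q y) \<and>
     (\<forall>x y. p (x * y) = p x * p y \<and> q (x * y) = q x * q y) \<and>
     (\<forall>a. p (\<iota> a) = a \<and> q (\<iota> a) = a) \<and>
     (\<forall>x. p (\<sigma> x) = q x \<and> q (\<sigma> x) = p x))"

text \<open>A quaternion algebra is a central simple algebra of dimension 4 (simplicity is implied by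
  divisibility). Its standard involution is the \<open>F\<close>-linear involution with
  \<open>x * \<sigma> x\<close> in \<open>F\<close> for all \<open>x\<close>.\<close>

definition case_quaternion :: "('f::field \<Rightarrow> 'k::ring_1) \<Rightarrow> ('k \<Rightarrow> 'k) \<Rightarrow> bool" where
  "case_quaternion \<iota> \<sigma> \<longleftrightarrow>
     (\<forall>x :: 'k. x \<noteq> 0 \<longrightarrow> (\<exists>y. x * y = 1 \<and> y * x = 1)) \<and>
     {x. \<forall>y. x * y = y * x} = range \<iota> \<and> dim_over \<iota> = 4 \<and>
     (\<forall>x y. \<sigma> (x + y) = \<sigma> x + \<sigma> y) \<and> (\<forall>x y. \<sigma> (x * y) = \<sigma> y * \<sigma> x) \<and>
     (\<forall>a. \<sigma> (\<iota> a) = \<iota> a) \<and> (\<forall>x. \<sigma> (\<sigma> x) = x) \<and> (\<forall>x. x * \<sigma> x \<in> range \<iota>)"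

definition is_order :: "('f::field \<Rightarrow> int) \<Rightarrow> ('f \<Rightarrow> 'k::ring_1) \<Rightarrow> 'k set \<Rightarrow> bool" where
  "is_order val \<iota> B \<longleftrightarrow>
     1 \<in> B \<and> (\<forall>x\<in>B. \<forall>y\<in>B. x - y \<in> B \<and> x * y \<in> B) \<and>
     (\<exists>S. finite S \<and> B = {\<Sum>s\<in>S. \<iota> (c s) * s | c. \<forall>s\<in>S. c s \<in> val_ge val 0}) \<and>
     (\<forall>x. \<exists>a\<in>val_ge val 0. a \<noteq> 0 \<and> \<iota> a * x \<in> B)"

definition maximal_order :: "('f::field \<Rightarrow> int) \<Rightarrow> ('f \<Rightarrow> 'k::ring_1) \<Rightarrow> 'k set \<Rightarrow> bool" where
  "maximal_order val \<iota> B \<longleftrightarrow>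
     is_order val \<iota> B \<and> (\<forall>B'. is_order val \<iota> B' \<and> B \<subseteq> B' \<longrightarrow> B' = B)"

section \<open>Hermitian spaces with a pair of lattices\<close>

text \<open>
  The following record serves both for the objects over \<open>A\<close>, namely
  \<open>K, \<sigma>, B, V, L, L\<^sup>#, h, \<epsilon>\<close>, and for their extensions to a flat \<open>A\<close>-algebra \<open>R\<close>, namely
  \<open>K \<otimes> R, \<sigma> \<otimes> id, B \<otimes> R, V \<otimes> R, L \<otimes> R, L\<^sup># \<otimes> R, h \<otimes> R, \<epsilon>\<close>.
  In the second case \<open>B \<otimes> R\<close>, \<open>L \<otimes> R\<close> and \<open>L\<^sup># \<otimes> R\<close> are subsets of \<open>K \<otimes> R\<close> and \<open>V \<otimes> R\<close>,
  which is legitimate because \<open>R\<close> is flat.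
  The field \<open>quad\<close> tells whether "hermitian form" means "quadratic form".
  The types of \<open>K \<otimes> R\<close> are of sort \<open>{ring, monoid_mult}\<close> instead of \<open>ring_1\<close>, so that
  the zero ring is not excluded.
\<close>

record ('k, 'v) herm =
  invol :: "'k \<Rightarrow> 'k"
  maxord :: "'k set"
  act :: "'v \<Rightarrow> 'k \<Rightarrow> 'v"
  lat :: "'v set"
  dlat :: "'v set"
  form :: "'v \<Rightarrow> 'v \<Rightarrow> 'k"
  eps :: int
  quad :: bool

definition right_module :: "('v::ab_group_add \<Rightarrow> 'k::{ring,monoid_mult} \<Rightarrow> 'v) \<Rightarrow> bool" where
  "right_module ac \<longleftrightarrow>
     (\<forall>v w k. ac (v + w) k = ac v k + ac w k) \<and> (\<forall>v k l. ac v (k + l) = ac v k + ac v l) \<and>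
     (\<forall>v k l. ac v (k * l) = ac (ac v k) l) \<and> (\<forall>v. ac v 1 = v)"

definition sesquilinear :: "('k::{ring,monoid_mult}, 'v::ab_group_add) herm \<Rightarrow>
    ('v \<Rightarrow> 'v \<Rightarrow> 'k) \<Rightarrow> bool" where
  "sesquilinear D f \<longleftrightarrow>
     (\<forall>v. additive (f v)) \<and> (\<forall>w. additive (\<lambda>v. f v w)) \<and>
     (\<forall>v w k l. f (act D v k) (act D w l) = invol D k * f v w * l) \<and>
     (\<forall>v w. f w v = (if eps D = 1 then invol D (f v w) else - invol D (f v w)))"

text \<open>\<open>f\<close> is the bilinear form
  \<open>f v w = (q (v + w) - q v - q w) / 2\<close> associated to the quadratic form \<open>q\<close> on \<open>L\<close>
  with values in \<open>B\<close> (resp. \<open>B \<otimes> R\<close>).\<close>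

definition associated :: "('k::{ring,monoid_mult}, 'v::ab_group_add) herm \<Rightarrow>
    ('v \<Rightarrow> 'k) \<Rightarrow> ('v \<Rightarrow> 'v \<Rightarrow> 'k) \<Rightarrow> bool" where
  "associated D q f \<longleftrightarrow>
     (\<forall>v\<in>lat D. q v \<in> maxord D) \<and>
     (\<forall>v\<in>lat D. \<forall>b\<in>maxord D. q (act D v b) = b * b * q v) \<and>
     (\<forall>v\<in>lat D. \<forall>w\<in>lat D. f v w + f v w = q (v + w) - q v - q w)"

text \<open>Forms on \<open>L\<close> are identified with their unique extensions to \<open>V\<close>. In the quadratic case a
  quadratic form is identified with its associated bilinear form, which determines it because
  2 is not a zero divisor.\<close>

definition hermitian_form :: "('k::{ring,monoid_mult}, 'v::ab_group_add) herm \<Rightarrow>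
    ('v \<Rightarrow> 'v \<Rightarrow> 'k) \<Rightarrow> bool" where
  "hermitian_form D f \<longleftrightarrow> sesquilinear D f \<and>
     (if quad D then \<exists>q. associated D q f else \<forall>v\<in>lat D. \<forall>w\<in>lat D. f v w \<in> maxord D)"

definition endos :: "('k::{ring,monoid_mult}, 'v::ab_group_add) herm \<Rightarrow> ('v \<Rightarrow> 'v) set" where
  "endos D = {X. additive X \<and> (\<forall>v k. X (act D v k) = act D (X v) k)}"

text \<open>Endomorphisms of \<open>L\<close> are identified with their extensions to \<open>V\<close>.\<close>

definition T0 :: "('k::{ring,monoid_mult}, 'v::ab_group_add) herm \<Rightarrow> ('v \<Rightarrow> 'v) set" where
  "T0 D = {X \<in> endos D. X ` lat D \<subseteq> lat D \<and> X ` dlat D \<subseteq> dlat D}"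

definition H0 :: "('k::{ring,monoid_mult}, 'v::ab_group_add) herm \<Rightarrow>
    ('v \<Rightarrow> 'v \<Rightarrow> 'k) set" where
  "H0 D = {f. hermitian_form D f \<and> (\<forall>v\<in>lat D. \<forall>w\<in>dlat D. f v w \<in> maxord D)}"

definition phi :: "('k, 'v) herm \<Rightarrow> ('v \<Rightarrow> 'v) \<Rightarrow> 'v \<Rightarrow> 'v \<Rightarrow> 'k" where
  "phi D X = (\<lambda>v w. form D (X v) (X w))"

definition psi :: "('k::{ring,monoid_mult}, 'v) herm \<Rightarrow> ('v \<Rightarrow> 'v) \<Rightarrow> 'v \<Rightarrow> 'v \<Rightarrow> 'k" where
  "psi D X = (\<lambda>v w. form D v (X w) + form D (X v) w)"

definition adj :: "('k::{ring,monoid_mult}, 'v::ab_group_add) herm \<Rightarrow> ('v \<Rightarrow> 'v) \<Rightarrow> 'v \<Rightarrow> 'v" where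
  "adj D X = (THE Y. Y \<in> endos D \<and> (\<forall>v w. form D (X v) w = form D v (Y w)))"

text \<open>The class of \<open>phi D X\<close> modulo the group \<open>psi D ` T D m\<close> vanishes iff it lies in this group.\<close>

fun T :: "('k::{ring,monoid_mult}, 'v::ab_group_add) herm \<Rightarrow> nat \<Rightarrow> ('v \<Rightarrow> 'v) set" where
  "T D 0 = T0 D"
| "T D (Suc m) =
     {X \<in> T D m. phi D X \<in> psi D ` T D m \<and> phi D (adj D X) \<in> psi D ` T D m}"

definition alpha :: "('k::{ring,monoid_mult}, 'v::ab_group_add) herm \<Rightarrow> nat" where
  "alpha D = (LEAST a. \<forall>m\<ge>a. T D m = T D a)"

text \<open>\<open>V\<close> is a right \<open>K\<close>-module, and \<open>V = L \<otimes>\<^sub>A F\<close> means that every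
  vector has a nonzero \<open>A\<close>-multiple in \<open>L\<close>.\<close>

definition hermitian_lattice :: "('f::field \<Rightarrow> int) \<Rightarrow> ('f \<Rightarrow> 'k::ring_1) \<Rightarrow> nat \<Rightarrow>
    ('k, 'v::ab_group_add) herm \<Rightarrow> bool" where
  "hermitian_lattice val \<iota> n D \<longleftrightarrow>
     nonarch_local_field val \<and> algebra_map \<iota> \<and>
     (case_base \<iota> (invol D) \<or> case_quadratic \<iota> (invol D) \<or>
      case_split \<iota> (invol D) \<or> case_quaternion \<iota> (invol D)) \<and>
     maximal_order val \<iota> (maxord D) \<and>
     eps D \<in> {1, - 1} \<and>
     (quad D \<longleftrightarrow> case_base \<iota> (invol D) \<and> eps D = 1 \<and> residue_char val = 2) \<and>
     right_module (act D) \<and>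
     (\<exists>e :: nat \<Rightarrow> 'v.
        lat D = {\<Sum>i<n. act D (e i) (b i) | b. \<forall>i<n. b i \<in> maxord D} \<and>
        (\<forall>b. (\<forall>i<n. b i \<in> maxord D) \<and> (\<Sum>i<n. act D (e i) (b i)) = 0 \<longrightarrow> (\<forall>i<n. b i = 0))) \<and>
     (\<forall>v. \<exists>a\<in>val_ge val 0. a \<noteq> 0 \<and> act D v (\<iota> a) \<in> lat D) \<and>
     hermitian_form D (form D) \<and>
     (\<forall>v. (\<forall>w. form D v w = 0) \<longrightarrow> v = 0) \<and>
     dlat D = {x. \<forall>l\<in>lat D. form D x l \<in> maxord D} \<and>
     {x. \<forall>y\<in>dlat D. form D x y \<in> maxord D} = lat D"

section \<open>Tensor products and flatness\<close>

text \<open>A multiset of pairs stands for the sum of the corresponding elementary tensors; as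
  \<open>- (x \<otimes> y) = (- x) \<otimes> y\<close>, no formal negatives are needed. Two formal sums are related iff they
  are equal in \<open>M \<otimes>\<^sub>A N\<close>.\<close>

inductive tensor_eq :: "('a, 'c) ring_scheme \<Rightarrow> ('a, 'm, 'd) module_scheme \<Rightarrow>
    ('a, 'n, 'e) module_scheme \<Rightarrow> ('m \<times> 'n) multiset \<Rightarrow> ('m \<times> 'n) multiset \<Rightarrow> bool"
  for A M N where
  refl: "set_mset s \<subseteq> carrier M \<times> carrier N \<Longrightarrow> tensor_eq A M N s s"
| sym: "tensor_eq A M N s t \<Longrightarrow> tensor_eq A M N t s"
| trans: "tensor_eq A M N s t \<Longrightarrow> tensor_eq A M N t u \<Longrightarrow> tensor_eq A M N s u"
| sum: "tensor_eq A M N s t \<Longrightarrow> tensor_eq A M N s' t' \<Longrightarrow> tensor_eq A M N (s + s') (t + t')"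
| zero: "y \<in> carrier N \<Longrightarrow> tensor_eq A M N {#(\<zero>\<^bsub>M\<^esub>, y)#} {#}"
| left: "x \<in> carrier M \<Longrightarrow> x' \<in> carrier M \<Longrightarrow> y \<in> carrier N \<Longrightarrow>
    tensor_eq A M N {#(x \<oplus>\<^bsub>M\<^esub> x', y)#} {#(x, y), (x', y)#}"
| right: "x \<in> carrier M \<Longrightarrow> y \<in> carrier N \<Longrightarrow> y' \<in> carrier N \<Longrightarrow>
    tensor_eq A M N {#(x, y \<oplus>\<^bsub>N\<^esub> y')#} {#(x, y), (x, y')#}"
| balanced: "a \<in> carrier A \<Longrightarrow> x \<in> carrier M \<Longrightarrow> y \<in> carrier N \<Longrightarrow>
    tensor_eq A M N {#(a \<odot>\<^bsub>M\<^esub> x, y)#} {#(x, a \<odot>\<^bsub>N\<^esub> y)#}"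

text \<open>The test modules \<open>M\<close>, \<open>M'\<close> have carriers in the element type of \<open>A\<close>. They include the
  ideals of \<open>A\<close> and (if that type is infinite) copies of all finitely generated
  \<open>A\<close>-modules, so this is no restriction.\<close>

definition flat :: "('a, 'c) ring_scheme \<Rightarrow> ('a, 'n, 'e) module_scheme \<Rightarrow> bool" where
  "flat A N \<longleftrightarrow> Module.module A N \<and>
     (\<forall>(M :: ('a, 'a) module) (M' :: ('a, 'a) module) j.
        Module.module A M \<and> Module.module A M' \<and>
        j \<in> carrier M \<rightarrow> carrier M' \<and>
        (\<forall>x\<in>carrier M. \<forall>y\<in>carrier M. j (x \<oplus>\<^bsub>M\<^esub> y) = j x \<oplus>\<^bsub>M'\<^esub> j y) \<and>
        (\<forall>a\<in>carrier A. \<forall>x\<in>carrier M. j (a \<odot>\<^bsub>M\<^esub> x) = a \<odot>\<^bsub>M'\<^esub> j x) \<and>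
        inj_on j (carrier M) \<longrightarrow>
        (\<forall>s t. set_mset s \<subseteq> carrier M \<times> carrier N \<and> set_mset t \<subseteq> carrier M \<times> carrier N \<and>
           tensor_eq A M' N (image_mset (map_prod j id) s) (image_mset (map_prod j id) t) \<longrightarrow>
           tensor_eq A M N s t))"

definition flat_algebra :: "('f::field \<Rightarrow> int) \<Rightarrow> ('f, 'r) module \<Rightarrow> bool" where
  "flat_algebra val R \<longleftrightarrow> algebra (int_ring val) R \<and> flat (int_ring val) R"

text \<open>An abelian group regarded as a module; the multiplicative fields of the record play no role.\<close>

definition as_module :: "('f \<Rightarrow> 'm \<Rightarrow> 'm) \<Rightarrow> ('f, 'm::ab_group_add) module" where
  "as_module sc = \<lparr>carrier = UNIV, monoid.mult = (\<lambda>_ _. 0), one = 0, ring.zero = 0, add = (+),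
     smult = sc\<rparr>"

text \<open>\<open>tau\<close> makes \<open>'p\<close> a tensor product of \<open>M\<close> and \<open>N\<close> over \<open>A\<close>: the group \<open>'p\<close> is the
  quotient of the formal sums of pairs by \<open>tensor_eq\<close>, with \<open>tau x y\<close> the class of \<open>(x, y)\<close>.\<close>

definition tensor_product :: "('a, 'c) ring_scheme \<Rightarrow> ('a, 'm, 'd) module_scheme \<Rightarrow>
    ('a, 'n, 'e) module_scheme \<Rightarrow> ('m \<Rightarrow> 'n \<Rightarrow> 'p::ab_group_add) \<Rightarrow> bool" where
  "tensor_product A M N tau \<longleftrightarrow>
     (\<forall>p. \<exists>s. set_mset s \<subseteq> carrier M \<times> carrier N \<and> p = (\<Sum>(x, y)\<in>#s. tau x y)) \<and>
     (\<forall>s t. set_mset s \<subseteq> carrier M \<times> carrier N \<and> set_mset t \<subseteq> carrier M \<times> carrier N \<longrightarrow>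
        ((\<Sum>(x, y)\<in>#s. tau x y) = (\<Sum>(x, y)\<in>#t. tau x y) \<longleftrightarrow> tensor_eq A M N s t))"

text \<open>The image of \<open>S \<otimes> R\<close>, for an \<open>A\<close>-submodule \<open>S\<close> of the left factor.\<close>

definition extend_set :: "('r, 'e) ring_scheme \<Rightarrow> ('m \<Rightarrow> 'r \<Rightarrow> 'p::ab_group_add) \<Rightarrow> 'm set \<Rightarrow> 'p set"
  where "extend_set R tau S = {\<Sum>(x, y)\<in>#s. tau x y | s. set_mset s \<subseteq> S \<times> carrier R}"

section \<open>Extension of scalars\<close>

text \<open>The elementary tensors \<open>x \<otimes> r\<close> in \<open>K \<otimes> R\<close> and \<open>v \<otimes> r\<close> in \<open>V \<otimes> R\<close>, and the
  extended data.\<close>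

record ('k, 'v, 'r, 'kr, 'vr) extension =
  tK :: "'k \<Rightarrow> 'r \<Rightarrow> 'kr"
  tV :: "'v \<Rightarrow> 'r \<Rightarrow> 'vr"
  dat :: "('kr, 'vr) herm"

definition scalar_extension :: "('f::field \<Rightarrow> int) \<Rightarrow> ('f \<Rightarrow> 'k::ring_1) \<Rightarrow>
    ('k, 'v::ab_group_add) herm \<Rightarrow> ('f, 'r) module \<Rightarrow>
    ('k, 'v, 'r, 'kr::{ring,monoid_mult}, 'vr::ab_group_add) extension \<Rightarrow> bool" where
  "scalar_extension val \<iota> D R E \<longleftrightarrow>
     tensor_product (int_ring val) (as_module (\<lambda>a x. \<iota> a * x)) R (tK E) \<and>
     tensor_product (int_ring val) (as_module (\<lambda>a v. act D v (\<iota> a))) R (tV E) \<and>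
     tK E 1 \<one>\<^bsub>R\<^esub> = 1 \<and>
     (\<forall>x y. \<forall>r\<in>carrier R. \<forall>s\<in>carrier R. tK E x r * tK E y s = tK E (x * y) (r \<otimes>\<^bsub>R\<^esub> s)) \<and>
     right_module (act (dat E)) \<and>
     (\<forall>v x. \<forall>r\<in>carrier R. \<forall>s\<in>carrier R.
        act (dat E) (tV E v r) (tK E x s) = tV E (act D v x) (r \<otimes>\<^bsub>R\<^esub> s)) \<and>
     additive (invol (dat E)) \<and>
     (\<forall>x. \<forall>r\<in>carrier R. invol (dat E) (tK E x r) = tK E (invol D x) r) \<and>
     maxord (dat E) = extend_set R (tK E) (maxord D) \<and>
     lat (dat E) = extend_set R (tV E) (lat D) \<and>
     dlat (dat E) = extend_set R (tV E) (dlat D) \<and>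
     (\<forall>u. additive (form (dat E) u)) \<and> (\<forall>u. additive (\<lambda>t. form (dat E) t u)) \<and>
     (\<forall>v w. \<forall>r\<in>carrier R. \<forall>s\<in>carrier R.
        form (dat E) (tV E v r) (tV E w s) = tK E (form D v w) (r \<otimes>\<^bsub>R\<^esub> s)) \<and>
     eps (dat E) = eps D \<and> quad (dat E) = quad D"

text \<open>The endomorphism of \<open>V \<otimes> R\<close> given by an elementary tensor \<open>r \<otimes> X\<close>.\<close>

definition end_tensor :: "('f, 'r) module \<Rightarrow>
    ('k, 'v, 'r, 'kr, 'vr::ab_group_add) extension \<Rightarrow> 'r \<Rightarrow> ('v \<Rightarrow> 'v) \<Rightarrow> 'vr \<Rightarrow> 'vr" where
  "end_tensor R E r X = (THE Z. additive Z \<and>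
     (\<forall>v. \<forall>s\<in>carrier R. Z (tV E v s) = tV E (X v) (s \<otimes>\<^bsub>R\<^esub> r)))"

text \<open>\<open>T\<^sup>0(R)\<close> is defined directly, \<open>T\<^sup>m(R) = R \<otimes>\<^sub>A T\<^sup>m(A)\<close> for \<open>m > 0\<close>; by flatness
  the latter is the \<open>R\<close>-span of \<open>T\<^sup>m(A)\<close> in the endomorphisms of \<open>V \<otimes> R\<close>.\<close>

fun T_ext :: "('k::ring_1, 'v::ab_group_add) herm \<Rightarrow> ('f, 'r) module \<Rightarrow>
    ('k, 'v, 'r, 'kr::{ring,monoid_mult}, 'vr::ab_group_add) extension \<Rightarrow> nat \<Rightarrow>
    ('vr \<Rightarrow> 'vr) set" where
  "T_ext D R E 0 = T0 (dat E)"
| "T_ext D R E (Suc m) = {(\<lambda>u. \<Sum>(r, X)\<in>#s. end_tensor R E r X u) | s.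
     set_mset s \<subseteq> carrier R \<times> T D (Suc m)}"

definition T_tilde :: "('k::ring_1, 'v::ab_group_add) herm \<Rightarrow> ('f, 'r) module \<Rightarrow>
    ('k, 'v, 'r, 'kr::{ring,monoid_mult}, 'vr::ab_group_add) extension \<Rightarrow> ('vr \<Rightarrow> 'vr) set" where
  "T_tilde D R E = T_ext D R E (alpha D)"

definition H_tilde :: "('k::ring_1, 'v::ab_group_add) herm \<Rightarrow> ('f, 'r) module \<Rightarrow>
    ('k, 'v, 'r, 'kr::{ring,monoid_mult}, 'vr::ab_group_add) extension \<Rightarrow>
    ('vr \<Rightarrow> 'vr \<Rightarrow> 'kr) set" where
  "H_tilde D R E = psi (dat E) ` T_tilde D R E"

section \<open>Functoriality\<close>

definition algebra_hom :: "('f::field \<Rightarrow> int) \<Rightarrow> ('f, 'r) module \<Rightarrow> ('f, 's) module \<Rightarrow>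
    ('r \<Rightarrow> 's) \<Rightarrow> bool" where
  "algebra_hom val R S g \<longleftrightarrow> g \<in> ring_hom R S \<and>
     (\<forall>a\<in>carrier (int_ring val). \<forall>r\<in>carrier R. g (a \<odot>\<^bsub>R\<^esub> r) = a \<odot>\<^bsub>S\<^esub> g r)"

text \<open>The map \<open>id \<otimes> g\<close> between tensor products.\<close>

definition tensor_map :: "('r, 'e) ring_scheme \<Rightarrow> ('m \<Rightarrow> 'r \<Rightarrow> 'p::ab_group_add) \<Rightarrow>
    ('m \<Rightarrow> 's \<Rightarrow> 'q::ab_group_add) \<Rightarrow> ('r \<Rightarrow> 's) \<Rightarrow> 'p \<Rightarrow> 'q" where
  "tensor_map R tau tau' g =
     (THE G. additive G \<and> (\<forall>x. \<forall>r\<in>carrier R. G (tau x r) = tau' x (g r)))"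

text \<open>Base change along \<open>g : R \<rightarrow> S\<close> of endomorphisms and of forms.\<close>

definition change_end :: "('f, 'r) module \<Rightarrow>
    ('k, 'v, 'r, 'kr::{ring,monoid_mult}, 'vr::ab_group_add) extension \<Rightarrow>
    ('k, 'v, 's, 'ks::{ring,monoid_mult}, 'vs::ab_group_add) extension \<Rightarrow>
    ('r \<Rightarrow> 's) \<Rightarrow> ('vr \<Rightarrow> 'vr) \<Rightarrow> 'vs \<Rightarrow> 'vs" where
  "change_end R E E' g X = (THE Y. Y \<in> endos (dat E') \<and>
     (\<forall>u. Y (tensor_map R (tV E) (tV E') g u) = tensor_map R (tV E) (tV E') g (X u)))"

definition change_form :: "('f, 'r) module \<Rightarrow>
    ('k, 'v, 'r, 'kr::{ring,monoid_mult}, 'vr::ab_group_add) extension \<Rightarrow>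
    ('k, 'v, 's, 'ks::{ring,monoid_mult}, 'vs::ab_group_add) extension \<Rightarrow>
    ('r \<Rightarrow> 's) \<Rightarrow> ('vr \<Rightarrow> 'vr \<Rightarrow> 'kr) \<Rightarrow> 'vs \<Rightarrow> 'vs \<Rightarrow> 'ks" where
  "change_form R E E' g f = (THE f'. sesquilinear (dat E') f' \<and>
     (\<forall>u w. f' (tensor_map R (tV E) (tV E') g u) (tensor_map R (tV E) (tV E') g w) =
        tensor_map R (tK E) (tK E') g (f u w)))"

end

theory Submission
  imports Defs
begin

text \<open>The set \<open>T\<^sup>m(A)\<close> is an \<open>A\<close>-module closed under products and adjoints, because
  \<open>\<phi>(X + Y) - \<phi>(X) - \<phi>(Y) = \<psi>(X\<^sup>a\<^sup>d Y)\<close>, and \<open>\<phi>(X) = \<psi>(Z)\<close> implies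
  \<open>\<phi>(X Y) = \<psi>(Y\<^sup>a\<^sup>d Z Y)\<close>. The chain of the \<open>T\<^sup>m(A)\<close> stabilizes: once the ranks are constant,
  there is a nonzero \<open>c\<close> in \<open>A\<close> with \<open>c T\<^sup>m(A) \<subseteq> T\<^sup>m\<^sup>+\<^sup>1(A)\<close>, and then \<open>c\<^sup>2 T\<^sup>m(A)\<close>
  lies in all later members, which leaves only finitely many steps. On the stable member \<open>\<phi>\<close> takes
  values in the image of \<open>\<psi>\<close>, and the formula for \<open>\<phi>(X + Y)\<close> extends this to sums of
  elementary tensors over \<open>R\<close>. Dual bases of \<open>V\<close> survive every extension of
  scalars; they provide adjoints and base change of endomorphisms.\<close>

section \<open>Descending chains of submodules over a valuation ring\<close>

text \<open>The main obstacle is stabilization: \<open>alpha\<close> is a \<open>LEAST\<close>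
  number, so nothing can be said about \<open>T_tilde\<close> before some stage of the chain is
  known to be final. The condition on \<open>adj D X\<close> in the recursion keeps each stage
  stable under adjoints; this is what allows the cross term X^ad Y of a sum to serve as part of a
  witness in the same stage. A second obstacle is the uneven definition of T^m(R): at level 0 it is
  cut out by lattice conditions, at positive levels it is spanned by elementary tensors. Computing
  with elementary tensors therefore settles alpha > 0, while alpha = 0 is reduced to the identity
  map. Over R, implications such as nondegeneracy are not inherited directly. They are derived anew
  from equations and memberships that can be checked on elementary tensors.\<close>

lemma nat_chain_stabilizes:
  fixes t :: "nat \<Rightarrow> nat"
  assumes mono: "\<And>m. m \<ge> m0 \<Longrightarrow> t m \<le> t (Suc m)" and bound: "\<And>m. m \<ge> m0 \<Longrightarrow> t m \<le> N"
  shows "\<exists>m1\<ge>m0. \<forall>m\<ge>m1. t m = t m1"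
proof -
  have le: "t m \<le> t m'" if "m0 \<le> m" "m \<le> m'" for m m'
    using that(2,1) by (induction m' rule: dec_induct) (auto intro: order_trans[OF _ mono])
  have "finite (t ` {m0..})"
    using bound by (intro finite_subset[OF _ finite_atMost[of N]]) auto
  then have "Max (t ` {m0..}) \<in> t ` {m0..}"
    by (intro Max_in) auto
  then obtain m1 where m1: "m1 \<ge> m0" "t m1 = Max (t ` {m0..})"
    by auto
  have "t m = t m1" if "m \<ge> m1" for m
    using le[OF m1(1) that] that m1 \<open>finite (t ` {m0..})\<close>
    by (metis Max_ge antisym atLeast_iff imageI order_trans)
  then show ?thesis
    using m1 by blast
qed

locale local_field =
  fixes val :: "'f::field \<Rightarrow> int"
  assumes local_field: "nonarch_local_field val"
begin

abbreviation A :: "'f set" where "A \<equiv> val_ge val 0"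

lemma val_mult: "x \<noteq> 0 \<Longrightarrow> y \<noteq> 0 \<Longrightarrow> val (x * y) = val x + val y"
  using local_field by (simp add: nonarch_local_field_def)

lemma val_1: "val 1 = 0"
  using val_mult[of 1 1] by simp

lemma val_minus: "x \<noteq> 0 \<Longrightarrow> val (- x) = val x"
proof -
  assume "x \<noteq> 0"
  moreover have "val (- 1) + val (- 1) = 0"
    using val_mult[of "- 1" "- 1"] val_1 by simp
  ultimately show ?thesis
    using val_mult[of "- 1" x] by simp
qed

lemma zero_mem_A: "0 \<in> A" and one_mem_A: "1 \<in> A"
  by (simp_all add: val_ge_def val_1)

lemma add_mem_A: "x \<in> A \<Longrightarrow> y \<in> A \<Longrightarrow> x + y \<in> A"
proof (cases "x = 0 \<or> y = 0 \<or> x + y = 0")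
  case False
  assume "x \<in> A" "y \<in> A"
  moreover have "val (x + y) \<ge> min (val x) (val y)"
    using local_field False by (simp add: nonarch_local_field_def)
  ultimately show ?thesis
    using False by (simp add: val_ge_def)
qed (auto simp: val_ge_def)

lemma mult_mem_A: "x \<in> A \<Longrightarrow> y \<in> A \<Longrightarrow> x * y \<in> A"
  by (cases "x = 0 \<or> y = 0") (auto simp: val_ge_def val_mult)

lemma minus_mem_A: "x \<in> A \<Longrightarrow> - x \<in> A"
  by (cases "x = 0") (auto simp: val_ge_def val_minus)

lemma diff_mem_A: "x \<in> A \<Longrightarrow> y \<in> A \<Longrightarrow> x - y \<in> A"
  using add_mem_A[of x "- y"] minus_mem_A[of y] by simp

lemma prod_mem_A: "(\<And>i. i \<in> I \<Longrightarrow> f i \<in> A) \<Longrightarrow> prod f I \<in> A"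
  by (induction I rule: infinite_finite_induct) (auto simp: one_mem_A mult_mem_A)

text \<open>Vectors of A^k are functions on \<open>nat\<close> that vanish from \<open>k\<close> on,
  so that equality of vectors is equality of functions.\<close>

definition submodule :: "nat \<Rightarrow> (nat \<Rightarrow> 'f) set \<Rightarrow> bool" where
  "submodule k C \<longleftrightarrow> (\<lambda>_. 0) \<in> C \<and>
     (\<forall>x\<in>C. (\<forall>i<k. x i \<in> A) \<and> (\<forall>i\<ge>k. x i = 0)) \<and>
     (\<forall>x\<in>C. \<forall>y\<in>C. (\<lambda>i. x i - y i) \<in> C) \<and>
     (\<forall>a\<in>A. \<forall>x\<in>C. (\<lambda>i. a * x i) \<in> C)"

text \<open>The ideals of leading coefficients of an echelon form: they are the graded pieces of
  \<open>C\<close> for the filtration by the number of initial zeros.\<close>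

definition lead :: "nat \<Rightarrow> (nat \<Rightarrow> 'f) set \<Rightarrow> 'f set" where
  "lead j C = {x j | x. x \<in> C \<and> (\<forall>i<j. x i = 0)}"

text \<open>The number of pivots is the rank of \<open>C\<close>.\<close>

definition pivots :: "nat \<Rightarrow> (nat \<Rightarrow> 'f) set \<Rightarrow> nat set" where
  "pivots k C = {j. j < k \<and> lead j C \<noteq> {0}}"

text \<open>The exponent of the ideal \<open>lead j C\<close>, which is generated by any element of
  least valuation. If that ideal is zero the value is arbitrary; it is only used at pivots.\<close>

definition pivot_val :: "(nat \<Rightarrow> 'f) set \<Rightarrow> nat \<Rightarrow> nat" where
  "pivot_val C j = (LEAST t. \<exists>x\<in>lead j C. x \<noteq> 0 \<and> val x = int t)"

lemma lead_mono: "C' \<subseteq> C \<Longrightarrow> lead j C' \<subseteq> lead j C"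
  by (auto simp: lead_def)

lemma zero_mem_lead: "submodule k C \<Longrightarrow> 0 \<in> lead j C"
  by (auto simp: lead_def submodule_def)

lemma pivots_mono: "submodule k C' \<Longrightarrow> C' \<subseteq> C \<Longrightarrow> pivots k C' \<subseteq> pivots k C"
  using lead_mono[of C' C] zero_mem_lead[of k C'] by (fastforce simp: pivots_def)

lemma submodule_diff: "submodule k C \<Longrightarrow> x \<in> C \<Longrightarrow> y \<in> C \<Longrightarrow> (\<lambda>i. x i - y i) \<in> C"
  by (simp add: submodule_def)

lemma submodule_scale: "submodule k C \<Longrightarrow> a \<in> A \<Longrightarrow> x \<in> C \<Longrightarrow> (\<lambda>i. a * x i) \<in> C"
  by (simp add: submodule_def)

lemma submodule_mem_A: "submodule k C \<Longrightarrow> x \<in> C \<Longrightarrow> x i \<in> A"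
  unfolding submodule_def by (metis not_le zero_mem_A)

lemma submodule_add:
  assumes "submodule k C" "x \<in> C" "y \<in> C"
  shows "(\<lambda>i. x i + y i) \<in> C"
proof -
  have "(\<lambda>i. - 1 * y i) \<in> C"
    using assms by (intro submodule_scale) (auto simp: one_mem_A minus_mem_A)
  from submodule_diff[OF assms(1,2) this] show ?thesis
    by simp
qed

text \<open>Elimination from the back: a vector of \<open>C\<close> with \<open>j\<close> initial
  zeros is corrected by a vector of \<open>C'\<close> with the same entry at \<open>j\<close>. The
  difference starts one place later and is in \<open>C'\<close> by induction.\<close>

lemma equal_lead_imp_equal:
  assumes C: "submodule k C" and C': "submodule k C'" and sub: "C' \<subseteq> C"
    and lead: "\<And>j. j < k \<Longrightarrow> lead j C \<subseteq> lead j C'"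
  shows "C = C'"
proof -
  have "x \<in> C'" if "j \<le> k" "x \<in> C" "\<forall>i<j. x i = 0" for j x
    using that
  proof (induction j arbitrary: x rule: inc_induct)
    case base
    then have "x i = 0" for i
      using C by (cases "i < k") (auto simp: submodule_def)
    then have "x = (\<lambda>_. 0)"
      by auto
    then show ?case
      using C' by (simp add: submodule_def)
  next
    case (step j)
    have "x j \<in> lead j C"
      using step.prems by (auto simp: lead_def)
    then obtain y where y: "y \<in> C'" "\<forall>i<j. y i = 0" "x j = y j"
      using lead[OF \<open>j < k\<close>] by (auto simp: lead_def)
    have "(\<lambda>i. x i - y i) \<in> C'"
      using y step sub by (intro step.IH submodule_diff[OF C]) (auto simp: less_Suc_eq)
    from submodule_add[OF C' this y(1)] show ?case
      by simp
  qed
  from this[of 0] sub show ?thesis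
    by auto
qed

text \<open>Elimination without division: the constant collects one nonzero leading entry from
  \<open>C'\<close> for each pivot of \<open>C\<close>, since an entry can be cleared after
  multiplication by it.\<close>

lemma equal_pivots_imp_commensurable:
  assumes C: "submodule k C" and C': "submodule k C'" and sub: "C' \<subseteq> C"
    and piv: "pivots k C \<subseteq> pivots k C'"
  shows "\<exists>c\<in>A. c \<noteq> 0 \<and> (\<forall>x\<in>C. (\<lambda>i. c * x i) \<in> C')"
proof -
  have "\<exists>c\<in>A. c \<noteq> 0 \<and> (\<forall>x\<in>C. (\<forall>i<j. x i = 0) \<longrightarrow> (\<lambda>i. c * x i) \<in> C')" if "j \<le> k" for j
    using that
  proof (induction j rule: inc_induct)
    case base
    have "x i = 0" if "x \<in> C" "\<forall>i<k. x i = 0" for x i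
      using C that by (cases "i < k") (auto simp: submodule_def)
    then have "x = (\<lambda>_. 0)" if "x \<in> C" "\<forall>i<k. x i = 0" for x
      using that by blast
    then have "\<forall>x\<in>C. (\<forall>i<k. x i = 0) \<longrightarrow> (\<lambda>i. 1 * x i) \<in> C'"
      using C' by (auto simp: submodule_def)
    then show ?case
      using one_mem_A by (intro bexI[of _ 1]) auto
  next
    case (step j)
    then obtain c where c: "c \<in> A" "c \<noteq> 0"
      and cC: "\<And>x. x \<in> C \<Longrightarrow> \<forall>i<Suc j. x i = 0 \<Longrightarrow> (\<lambda>i. c * x i) \<in> C'"
      by blast
    show ?case
    proof (cases "lead j C = {0}")
      case True
      then have "x j = 0" if "x \<in> C" "\<forall>i<j. x i = 0" for x
        using that by (auto simp: lead_def)
      then show ?thesis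
        using c cC by (intro bexI[of _ c]) (auto simp: less_Suc_eq)
    next
      case False
      then have "j \<in> pivots k C'"
        using piv \<open>j < k\<close> by (auto simp: pivots_def)
      then obtain b where b: "b \<in> C'" "\<forall>i<j. b i = 0" "b j \<noteq> 0"
        using zero_mem_lead[OF C', of j] by (auto simp: pivots_def lead_def)
      have "(\<lambda>i. c * b j * x i) \<in> C'" if x: "x \<in> C" "\<forall>i<j. x i = 0" for x
      proof -
        have xb: "x j \<in> A" "b j \<in> A"
          using x b submodule_mem_A C C' by auto
        \<comment> \<open>Cross-multiplication clears entry \<open>j\<close>, so the constant of the
          later places applies; the subtracted multiple of \<open>b\<close> is then added back
          inside \<open>C'\<close>.\<close>
        have "(\<lambda>i. c * (b j * x i - x j * b i)) \<in> C'"
          using x b xb sub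
          by (intro cC submodule_diff[OF C] submodule_scale[OF C]) (auto simp: less_Suc_eq)
        moreover have "(\<lambda>i. c * x j * b i) \<in> C'"
          using b c xb by (intro submodule_scale[OF C'] mult_mem_A) auto
        ultimately have "(\<lambda>i. c * (b j * x i - x j * b i) + c * x j * b i) \<in> C'"
          by (rule submodule_add[OF C'])
        then show ?thesis
          by (simp add: algebra_simps)
      qed
      moreover have "c * b j \<in> A" "c * b j \<noteq> 0"
        using b c submodule_mem_A[OF C'] mult_mem_A by auto
      ultimately show ?thesis
        by blast
    qed
  qed
  from this[of 0] show ?thesis
    by auto
qed

lemma pivot_val_attained:
  assumes "submodule k C" "j \<in> pivots k C"
  shows "\<exists>x\<in>lead j C. x \<noteq> 0 \<and> val x = int (pivot_val C j)"
proof -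
  obtain x where x: "x \<in> lead j C" "x \<noteq> 0"
    using assms zero_mem_lead[of k C j] by (auto simp: pivots_def)
  then have "x \<in> A"
    using assms submodule_mem_A by (auto simp: lead_def)
  then have "\<exists>t. \<exists>x\<in>lead j C. x \<noteq> 0 \<and> val x = int t"
    using x by (auto simp: val_ge_def intro!: exI[of _ "nat (val x)"] bexI[of _ x])
  then show ?thesis
    unfolding pivot_val_def by (rule LeastI_ex)
qed

lemma pivot_val_le:
  assumes "submodule k C" "x \<in> lead j C" "x \<noteq> 0"
  shows "int (pivot_val C j) \<le> val x"
proof -
  have "x \<in> A"
    using assms submodule_mem_A by (auto simp: lead_def)
  then have v: "val x = int (nat (val x))"
    using assms by (auto simp: val_ge_def)
  have "pivot_val C j \<le> nat (val x)"
    unfolding pivot_val_def using assms v by (intro Least_le) blast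
  then show ?thesis
    using v by linarith
qed

lemma lead_scale:
  assumes "submodule k C" "x \<in> lead j C" "a \<in> A"
  shows "a * x \<in> lead j C"
proof -
  from assms obtain y where y: "y \<in> C" "\<forall>i<j. y i = 0" "x = y j"
    by (auto simp: lead_def)
  have "(\<lambda>i. a * y i) \<in> C"
    using y assms submodule_scale by blast
  then show ?thesis
    using y unfolding lead_def by (auto intro!: exI[of _ "\<lambda>i. a * y i"])
qed

text \<open>A chain like \<open>\<pi>\<^sup>m A\<^sup>k\<close> shows that the last hypothesis cannot be dropped: with a constant rank,
  the consecutive members are commensurable, and the hypothesis makes this uniform.\<close>

lemma submodule_chain_stabilizes:
  assumes C: "\<And>m. submodule k (C m)" and desc: "\<And>m. C (Suc m) \<subseteq> C m"
    and uniform: "\<And>m c. c \<in> A \<Longrightarrow> c \<noteq> 0 \<Longrightarrow> \<forall>x\<in>C m. (\<lambda>i. c * x i) \<in> C (Suc m) \<Longrightarrow>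
      \<exists>d\<in>A. d \<noteq> 0 \<and> (\<forall>m'\<ge>m. \<forall>x\<in>C m. (\<lambda>i. d * x i) \<in> C m')"
  shows "\<exists>m0. \<forall>m\<ge>m0. C m = C m0"
proof -
  have anti: "C m' \<subseteq> C m" if "m \<le> m'" for m m'
    using that by (induction m' rule: dec_induct) (use desc in auto)
  have fin: "finite (pivots k (C m))" for m
    by (rule finite_subset[of _ "{..<k}"]) (auto simp: pivots_def)
  have cardle: "card (pivots k (C m)) \<le> k" for m
    using card_mono[of "{..<k}" "pivots k (C m)"] by (auto simp: pivots_def)
  have pm: "pivots k (C m') \<subseteq> pivots k (C m)" if "m \<le> m'" for m m'
    using anti[OF that] C pivots_mono by blast
  \<comment> \<open>The pivot sets shrink, while the stabilization lemma speaks of growing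
    sequences; hence the corank.\<close>
  obtain m0 where m0: "\<forall>m\<ge>m0. k - card (pivots k (C m)) = k - card (pivots k (C m0))"
    using nat_chain_stabilizes[of 0 "\<lambda>m. k - card (pivots k (C m))" k]
    by (metis card_mono diff_le_mono2 diff_le_self fin lessI less_imp_le pm)
  have piv: "pivots k (C m) = pivots k (C m0)" if "m \<ge> m0" for m
    using card_subset_eq[OF fin pm[OF that]] m0 that cardle
    by (metis diff_diff_cancel)
  have "pivots k (C m0) \<subseteq> pivots k (C (Suc m0))"
    using piv[of "Suc m0"] by simp
  from equal_pivots_imp_commensurable[OF C C desc this]
  obtain c where "c \<in> A" "c \<noteq> 0" "\<forall>x\<in>C m0. (\<lambda>i. c * x i) \<in> C (Suc m0)"
    by blast
  from uniform[OF this] obtain d where d: "d \<in> A" "d \<noteq> 0"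
    and dC: "\<And>m x. m \<ge> m0 \<Longrightarrow> x \<in> C m0 \<Longrightarrow> (\<lambda>i. d * x i) \<in> C m"
    by auto
  define J where "J = pivots k (C m0)"
  have J: "finite J" "\<And>m. m \<ge> m0 \<Longrightarrow> pivots k (C m) = J"
    unfolding J_def by (rule fin, rule piv)
  define t where "t m j = pivot_val (C m) j" for m j
  have attained: "\<exists>x\<in>lead j (C m). x \<noteq> 0 \<and> val x = int (t m j)" if "m0 \<le> m" "j \<in> J" for m j
    unfolding t_def by (rule pivot_val_attained[OF C]) (use J(2)[OF that(1)] that(2) in simp)
  have tmono: "t m j \<le> t m' j" if le: "m0 \<le> m" "m \<le> m'" and j: "j \<in> J" for m m' j
  proof -
    obtain x where "x \<in> lead j (C m')" "x \<noteq> 0" "val x = int (t m' j)"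
      using attained[OF order_trans[OF le] j] by auto
    then show ?thesis
      using pivot_val_le[OF C, of x j m] lead_mono[OF anti[OF le(2)]] by (auto simp: t_def)
  qed
  \<comment> \<open>Since \<open>d\<close> times \<open>C m0\<close> stays in every later member, no
    exponent can grow by more than the valuation of \<open>d\<close>.\<close>
  have tbound: "t m j \<le> t m0 j + nat (val d)" if m: "m0 \<le> m" and j: "j \<in> J" for m j
  proof -
    obtain x where x: "x \<in> lead j (C m0)" "x \<noteq> 0" "val x = int (t m0 j)"
      using attained[OF order_refl j] by auto
    then obtain y where "y \<in> C m0" "\<forall>i<j. y i = 0" "x = y j"
      by (auto simp: lead_def)
    then have "d * x \<in> lead j (C m)"
      unfolding lead_def using dC[OF m, of y] by (auto intro!: exI[of _ "\<lambda>i. d * y i"])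
    then have "int (t m j) \<le> val (d * x)"
      using x d pivot_val_le[OF C] by (auto simp: t_def)
    then show ?thesis
      using x d by (simp add: val_mult)
  qed
  \<comment> \<open>One bounded quantity serves all pivots at once: every summand is nondecreasing,
    so a constant sum makes every exponent constant.\<close>
  have "\<exists>m1\<ge>m0. \<forall>m\<ge>m1. sum (t m) J = sum (t m1) J"
    using tmono tbound
    by (intro nat_chain_stabilizes[where N = "\<Sum>j\<in>J. t m0 j + nat (val d)"] sum_mono) auto
  then obtain m1 where m1: "m1 \<ge> m0" "\<And>m. m \<ge> m1 \<Longrightarrow> sum (t m) J = sum (t m1) J"
    by blast
  have teq: "t m j = t m1 j" if "m \<ge> m1" "j \<in> J" for m j
  proof (rule ccontr)
    assume "t m j \<noteq> t m1 j"
    then have "sum (t m1) J < sum (t m) J"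
      using J(1) that m1(1) tmono[of m1 m] tmono[of m1 m j]
      by (intro sum_strict_mono_ex1) (auto intro!: bexI[of _ j] simp: order_less_le)
    with m1(2)[OF that(1)] show False
      by simp
  qed
  have "C m1 = C m" if m: "m \<ge> m1" for m
  proof (rule equal_lead_imp_equal[OF C C anti[OF m]])
    fix j assume "j < k"
    show "lead j (C m1) \<subseteq> lead j (C m)"
    proof
      fix x assume x: "x \<in> lead j (C m1)"
      show "x \<in> lead j (C m)"
      proof (cases "x = 0")
        case True
        then show ?thesis
          using zero_mem_lead[OF C] by simp
      next
        case False
        then have j: "j \<in> J"
          using x \<open>j < k\<close> J(2)[OF m1(1)] by (auto simp: pivots_def)
        then obtain y where y: "y \<in> lead j (C m)" "y \<noteq> 0" "val y = int (t m j)"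
          using attained[OF order_trans[OF m1(1) m] j] by auto
        have "val y \<le> val x"
          using pivot_val_le[OF C x False] y teq[OF m j] by (simp add: t_def)
        moreover have "val x = val (x / y) + val y"
          using val_mult[of "x / y" y] False y by simp
        \<comment> \<open>With equal exponents, \<open>y\<close> has least valuation already in
          \<open>lead j (C m1)\<close>, so it divides \<open>x\<close>.\<close>
        ultimately have "x / y \<in> A"
          by (simp add: val_ge_def)
        from lead_scale[OF C y(1) this] y(2) show ?thesis
          by simp
      qed
    qed
  qed
  then show ?thesis
    by metis
qed

end

section \<open>Sesquilinear spaces with dual bases\<close>

text \<open>Common ground of the data over A and of their extensions to R.\<close>

locale sesq_space =
  fixes D :: "('k::{ring,monoid_mult}, 'v::ab_group_add) herm"
  assumes right_module: "right_module (act D)"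
    and form_sesquilinear: "sesquilinear D (form D)"
begin

abbreviation h :: "'v \<Rightarrow> 'v \<Rightarrow> 'k" where "h \<equiv> form D"

abbreviation scale :: "'v \<Rightarrow> 'k \<Rightarrow> 'v" (infixl \<open>\<cdot>\<close> 75) where "v \<cdot> k \<equiv> act D v k"

lemma act_add_left: "(v + w) \<cdot> k = v \<cdot> k + w \<cdot> k"
  and act_add_right: "v \<cdot> (k + l) = v \<cdot> k + v \<cdot> l"
  and act_mult: "v \<cdot> (k * l) = v \<cdot> k \<cdot> l"
  and act_one: "v \<cdot> 1 = v"
  using right_module by (simp_all add: right_module_def)

lemma additive_act: "additive (\<lambda>v. v \<cdot> k)" "additive (act D v)"
  by (simp_all add: additive_def act_add_left act_add_right)

lemma additive_h: "additive (h v)" "additive (\<lambda>v. h v w)"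
  using form_sesquilinear[unfolded sesquilinear_def] by blast+

lemmas act_sum_left = additive.sum[OF additive_act(1)]
lemmas h_add_right = additive.add[OF additive_h(1)]
lemmas h_add_left = additive.add[OF additive_h(2)]
lemmas h_zero_right = additive.zero[OF additive_h(1)]
lemmas h_zero_left = additive.zero[OF additive_h(2)]
lemmas h_sum_right = additive.sum[OF additive_h(1)]
lemmas h_sum_left = additive.sum[OF additive_h(2)]

lemma h_act: "h (v \<cdot> k) (w \<cdot> l) = invol D k * h v w * l"
  using form_sesquilinear[unfolded sesquilinear_def] by blast

text \<open>That the involution fixes 1 is not an axiom here. The stray factor
  \<open>invol D 1\<close> is absorbed by comparing with the case \<open>l = 1\<close>.\<close>

lemma h_act_right: "h v (w \<cdot> l) = h v w * l"
  using h_act[of v 1 w l] h_act[of v 1 w 1] by (simp add: act_one)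

lemma h_act_left: "h (v \<cdot> k) w = invol D k * h v w"
  using h_act[of v k w 1] by (simp add: act_one)

lemma h_symmetric: "h w v = (if eps D = 1 then invol D (h v w) else - invol D (h v w))"
  using form_sesquilinear[unfolded sesquilinear_def] by blast

lemma endosI: "additive X \<Longrightarrow> (\<And>v k. X (v \<cdot> k) = X v \<cdot> k) \<Longrightarrow> X \<in> endos D"
  by (simp add: endos_def)

lemma endos_additive: "X \<in> endos D \<Longrightarrow> additive X"
  and endos_act: "X \<in> endos D \<Longrightarrow> X (v \<cdot> k) = X v \<cdot> k"
  by (simp_all add: endos_def)

lemma endos_comp: "X \<in> endos D \<Longrightarrow> Y \<in> endos D \<Longrightarrow> (\<lambda>v. X (Y v)) \<in> endos D"
  by (simp add: endos_def additive_def)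

lemma endos_add: "X \<in> endos D \<Longrightarrow> Y \<in> endos D \<Longrightarrow> (\<lambda>v. X v + Y v) \<in> endos D"
  by (simp add: endos_def additive_def act_add_left)

lemma endos_zero: "(\<lambda>v. 0) \<in> endos D"
  using additive.zero[OF additive_act(1)] by (simp add: endos_def additive_def)

end

text \<open>The vectors \<open>e\<close> form a basis of L and \<open>b\<close> is dual to it from
  the right. The family \<open>c\<close> is dual from the left, because h is symmetric only up to
  sign and involution; in the construction below it equals \<open>b\<close> up to sign.\<close>

locale dual_bases = sesq_space D
  for D :: "('k::{ring,monoid_mult}, 'v::ab_group_add) herm" +
  fixes n :: nat and e b c :: "nat \<Rightarrow> 'v"
  assumes h_dual: "\<And>i j. i < n \<Longrightarrow> j < n \<Longrightarrow> h (e i) (b j) = (if i = j then 1 else 0)"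
    and expand_b: "\<And>v. (\<Sum>i<n. b i \<cdot> h (e i) v) = v"
    and expand_e: "\<And>v. (\<Sum>i<n. e i \<cdot> h (c i) v) = v"
    and e_mem: "\<And>i. i < n \<Longrightarrow> e i \<in> lat D"
    and b_mem: "\<And>i. i < n \<Longrightarrow> b i \<in> dlat D"
    and c_mem: "\<And>i. i < n \<Longrightarrow> c i \<in> dlat D"
    and maxord_add: "\<And>x y. x \<in> maxord D \<Longrightarrow> y \<in> maxord D \<Longrightarrow> x + y \<in> maxord D"
    and lat_zero: "0 \<in> lat D"
    and lat_add: "\<And>v w. v \<in> lat D \<Longrightarrow> w \<in> lat D \<Longrightarrow> v + w \<in> lat D"
    and lat_act: "\<And>v k. v \<in> lat D \<Longrightarrow> k \<in> maxord D \<Longrightarrow> v \<cdot> k \<in> lat D"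
    and dlat_zero: "0 \<in> dlat D"
    and dlat_add: "\<And>v w. v \<in> dlat D \<Longrightarrow> w \<in> dlat D \<Longrightarrow> v + w \<in> dlat D"
    and dlat_act: "\<And>v k. v \<in> dlat D \<Longrightarrow> k \<in> maxord D \<Longrightarrow> v \<cdot> k \<in> dlat D"
    and h_lat_dlat: "\<And>v w. v \<in> lat D \<Longrightarrow> w \<in> dlat D \<Longrightarrow> h v w \<in> maxord D"
    and h_dlat_lat: "\<And>v w. v \<in> dlat D \<Longrightarrow> w \<in> lat D \<Longrightarrow> h v w \<in> maxord D"
begin

lemma lat_sum: "(\<And>i. i \<in> I \<Longrightarrow> f i \<in> lat D) \<Longrightarrow> sum f I \<in> lat D"
  by (induction I rule: infinite_finite_induct) (auto simp: lat_zero lat_add)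

lemma dlat_sum: "(\<And>i. i \<in> I \<Longrightarrow> f i \<in> dlat D) \<Longrightarrow> sum f I \<in> dlat D"
  by (induction I rule: infinite_finite_induct) (auto simp: dlat_zero dlat_add)

section \<open>Adjoints and their effect on the two lattices\<close>

lemma nondegenerate:
  assumes "\<And>v. h v w = h v w'"
  shows "w = w'"
proof -
  have "w = (\<Sum>i<n. b i \<cdot> h (e i) w)"
    by (rule expand_b[symmetric])
  also have "\<dots> = (\<Sum>i<n. b i \<cdot> h (e i) w')"
    by (simp only: assms)
  also have "\<dots> = w'"
    by (rule expand_b)
  finally show ?thesis .
qed

text \<open>Taking \<open>v = e j\<close> prescribes h(e j, Y w) = h(X (e j), w), and these values
  are the coordinates of Y w with respect to \<open>b\<close>. Expanding \<open>v\<close> in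
  \<open>e\<close> gives the general case.\<close>

lemma adjoint_exists:
  assumes X: "X \<in> endos D"
  shows "\<exists>Y\<in>endos D. \<forall>v w. h (X v) w = h v (Y w)"
proof (intro bexI allI)
  define Y where "Y w = (\<Sum>i<n. b i \<cdot> h (X (e i)) w)" for w
  show "Y \<in> endos D"
    by (intro endosI) (simp_all add: Y_def additive_def h_add_right act_add_right sum.distrib
        h_act_right act_mult act_sum_left)
  fix v w
  have *: "h (e j) (Y w) = h (X (e j)) w" if "j < n" for j
  proof -
    have "h (e j) (Y w) = (\<Sum>i<n. h (e j) (b i) * h (X (e i)) w)"
      by (simp add: Y_def h_sum_right h_act_right)
    also have "\<dots> = (\<Sum>i<n. if j = i then h (X (e i)) w else 0)"
      using that by (intro sum.cong) (simp_all add: h_dual)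
    also have "\<dots> = h (X (e j)) w"
      using that by simp
    finally show ?thesis .
  qed
  have "h (X v) w = h (X (\<Sum>i<n. e i \<cdot> h (c i) v)) w"
    by (simp add: expand_e)
  also have "\<dots> = (\<Sum>i<n. invol D (h (c i) v) * h (X (e i)) w)"
    by (simp add: additive.sum[OF endos_additive[OF X]] endos_act[OF X] h_sum_left h_act_left)
  also have "\<dots> = (\<Sum>i<n. invol D (h (c i) v) * h (e i) (Y w))"
    by (intro sum.cong) (simp_all add: *)
  also have "\<dots> = h (\<Sum>i<n. e i \<cdot> h (c i) v) (Y w)"
    by (simp add: h_sum_left h_act_left)
  also have "\<dots> = h v (Y w)"
    by (simp add: expand_e)
  finally show "h (X v) w = h v (Y w)" .
qed

lemma adj:
  assumes X: "X \<in> endos D"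
  shows "adj D X \<in> endos D" and "h (X v) w = h v (adj D X w)"
proof -
  have "Y = Z" if "\<forall>v w. h (X v) w = h v (Y w)" "\<forall>v w. h (X v) w = h v (Z w)" for Y Z
  proof
    fix w
    show "Y w = Z w"
      by (rule nondegenerate) (use that in metis)
  qed
  then have "\<exists>!Y. Y \<in> endos D \<and> (\<forall>v w. h (X v) w = h v (Y w))"
    using adjoint_exists[OF X] by blast
  from theI'[OF this, folded adj_def]
  show "adj D X \<in> endos D" "h (X v) w = h v (adj D X w)"
    by blast+
qed

text \<open>By hermitian symmetry both sides are, with the same sign, the involution of h(X w,
  v).\<close>

lemma h_endo_right: "X \<in> endos D \<Longrightarrow> h v (X w) = h (adj D X v) w"
  using h_symmetric[of "adj D X v" w] h_symmetric[of v "X w"] by (simp add: adj(2))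

lemma adj_eqI: "X \<in> endos D \<Longrightarrow> (\<And>v w. h (X v) w = h v (Y w)) \<Longrightarrow> adj D X = Y"
  by (rule ext, rule nondegenerate) (metis adj(2))

lemma adj_adj: "X \<in> endos D \<Longrightarrow> adj D (adj D X) = X"
  by (rule adj_eqI[OF adj(1)]) (simp_all only: h_endo_right)

lemma adj_comp:
  assumes "X \<in> endos D" "Y \<in> endos D"
  shows "adj D (\<lambda>v. X (Y v)) = (\<lambda>v. adj D Y (adj D X v))"
  by (rule adj_eqI[OF endos_comp[OF assms]])
    (simp only: adj(2)[OF assms(1)] adj(2)[OF assms(2)])

lemma adj_add:
  assumes "X \<in> endos D" "Y \<in> endos D"
  shows "adj D (\<lambda>v. X v + Y v) = (\<lambda>v. adj D X v + adj D Y v)"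
  by (rule adj_eqI[OF endos_add[OF assms]])
    (simp only: h_add_left h_add_right adj(2)[OF assms(1)] adj(2)[OF assms(2)])

lemma adj_zero: "adj D (\<lambda>v. 0) = (\<lambda>v. 0)"
  by (rule adj_eqI[OF endos_zero]) (simp add: h_zero_left h_zero_right)

lemma T0_endos: "X \<in> T0 D \<Longrightarrow> X \<in> endos D"
  and T0_lat: "X \<in> T0 D \<Longrightarrow> v \<in> lat D \<Longrightarrow> X v \<in> lat D"
  and T0_dlat: "X \<in> T0 D \<Longrightarrow> v \<in> dlat D \<Longrightarrow> X v \<in> dlat D"
  by (auto simp: T0_def)

lemma T0I:
  "X \<in> endos D \<Longrightarrow> (\<And>v. v \<in> lat D \<Longrightarrow> X v \<in> lat D) \<Longrightarrow> (\<And>v. v \<in> dlat D \<Longrightarrow> X v \<in> dlat D) \<Longrightarrow>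
    X \<in> T0 D"
  by (auto simp: T0_def)

lemma T0_comp: "X \<in> T0 D \<Longrightarrow> Y \<in> T0 D \<Longrightarrow> (\<lambda>v. X (Y v)) \<in> T0 D"
  by (rule T0I, rule endos_comp) (simp_all add: T0_endos T0_lat T0_dlat)

lemma T0_add: "X \<in> T0 D \<Longrightarrow> Y \<in> T0 D \<Longrightarrow> (\<lambda>v. X v + Y v) \<in> T0 D"
  by (rule T0I, rule endos_add) (simp_all add: T0_endos T0_lat T0_dlat lat_add dlat_add)

lemma T0_zero: "(\<lambda>v. 0) \<in> T0 D"
  by (rule T0I, rule endos_zero) (simp_all add: lat_zero dlat_zero)

text \<open>The coordinates of the image of \<open>w\<close> are h(X (c i), w) in \<open>e\<close>
  and h(X (e i), w) in \<open>b\<close>. So the adjoint preserves L because X preserves the dual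
  lattice, and vice versa.\<close>

lemma T0_adj:
  assumes X: "X \<in> T0 D"
  shows "adj D X \<in> T0 D"
proof (rule T0I)
  note Xe = T0_endos[OF X]
  show "adj D X \<in> endos D"
    using Xe by (rule adj(1))
  show "adj D X w \<in> lat D" if "w \<in> lat D" for w
  proof -
    have "adj D X w = (\<Sum>i<n. e i \<cdot> h (c i) (adj D X w))"
      by (simp add: expand_e)
    also have "\<dots> = (\<Sum>i<n. e i \<cdot> h (X (c i)) w)"
      by (simp add: adj(2)[OF Xe])
    also have "\<dots> \<in> lat D"
      using that by (intro lat_sum lat_act e_mem h_dlat_lat T0_dlat[OF X] c_mem) auto
    finally show ?thesis .
  qed
  show "adj D X w \<in> dlat D" if "w \<in> dlat D" for w
  proof -
    have "adj D X w = (\<Sum>i<n. b i \<cdot> h (e i) (adj D X w))"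
      by (simp add: expand_b)
    also have "\<dots> = (\<Sum>i<n. b i \<cdot> h (X (e i)) w)"
      by (simp add: adj(2)[OF Xe])
    also have "\<dots> \<in> dlat D"
      using that by (intro dlat_sum dlat_act b_mem h_lat_dlat T0_lat[OF X] e_mem) auto
    finally show ?thesis .
  qed
qed

section \<open>Relations between \<open>phi\<close> and \<open>psi\<close>, and closure properties
  of the stages\<close>

lemma phi_add:
  assumes "X \<in> endos D" "Y \<in> endos D" "phi D X = psi D Z" "phi D Y = psi D Z'"
    "Z \<in> endos D" "Z' \<in> endos D"
  shows "phi D (\<lambda>v. X v + Y v) = psi D (\<lambda>v. Z v + Z' v + adj D X (Y v))"
proof (intro ext)
  fix v w
  have "h (X v) (X w) = h v (Z w) + h (Z v) w" "h (Y v) (Y w) = h v (Z' w) + h (Z' v) w"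
    using fun_cong[OF fun_cong[OF assms(3)]] fun_cong[OF fun_cong[OF assms(4)]]
    by (simp_all add: phi_def psi_def)
  moreover have "h (X v) (Y w) = h v (adj D X (Y w))" "h (Y v) (X w) = h (adj D X (Y v)) w"
    by (simp_all only: adj(2)[OF assms(1)] h_endo_right[OF assms(1)])
  ultimately show
    "phi D (\<lambda>v. X v + Y v) v w = psi D (\<lambda>v. Z v + Z' v + adj D X (Y v)) v w"
    by (simp add: phi_def psi_def h_add_left h_add_right algebra_simps)
qed

lemma phi_comp:
  assumes "X \<in> endos D" "Y \<in> endos D" "phi D X = psi D Z" "Z \<in> endos D"
  shows "phi D (\<lambda>v. X (Y v)) = psi D (\<lambda>v. adj D Y (Z (Y v)))"
proof (intro ext)
  fix v w
  have "h (X (Y v)) (X (Y w)) = h (Y v) (Z (Y w)) + h (Z (Y v)) (Y w)"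
    using fun_cong[OF fun_cong[OF assms(3)]] by (simp_all add: phi_def psi_def)
  then show "phi D (\<lambda>v. X (Y v)) v w = psi D (\<lambda>v. adj D Y (Z (Y v))) v w"
    by (simp only: phi_def psi_def adj(2)[OF assms(2)] h_endo_right[OF assms(2)])
qed

lemma T_antimono: "m \<le> m' \<Longrightarrow> T D m' \<subseteq> T D m"
  by (induction m' rule: dec_induct) auto

lemma T_endos: "X \<in> T D m \<Longrightarrow> X \<in> endos D"
  using T_antimono[of 0 m] by (auto intro: T0_endos)

lemma T_zero: "(\<lambda>v. 0) \<in> T D m"
proof (induction m)
  case (Suc m)
  have "phi D (\<lambda>v. 0) = psi D (\<lambda>v. 0)"
    by (simp add: phi_def psi_def h_zero_left h_zero_right fun_eq_iff)
  then show ?case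
    using Suc by (auto simp: adj_zero)
qed (simp add: T0_zero)

lemma T_adj: "X \<in> T D m \<Longrightarrow> adj D X \<in> T D m"
  by (induction m arbitrary: X) (auto simp: T0_adj adj_adj T_endos)

text \<open>Sums and products need a joint induction: the witness for a sum at the next stage
  contains the product of X^ad and Y, which has to lie in the present stage. The condition on
  adjoints is the same argument applied to the adjoints, in reversed order for a product.\<close>

lemma T_add_comp:
  "(\<forall>X\<in>T D m. \<forall>Y\<in>T D m. (\<lambda>v. X v + Y v) \<in> T D m) \<and>
   (\<forall>X\<in>T D m. \<forall>Y\<in>T D m. (\<lambda>v. X (Y v)) \<in> T D m)"
proof (induction m)
  case 0
  then show ?case
    by (simp add: T0_add T0_comp)
next
  case (Suc m)
  note add_mem = conjunct1[OF Suc.IH, rule_format]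
  note comp_mem = conjunct2[OF Suc.IH, rule_format]
  have add: "phi D (\<lambda>v. X v + Y v) \<in> psi D ` T D m"
    if XY: "X \<in> T D m" "Y \<in> T D m" and "phi D X \<in> psi D ` T D m" "phi D Y \<in> psi D ` T D m"
    for X Y
  proof -
    from that obtain Z Z' where Z: "phi D X = psi D Z" "Z \<in> T D m"
      "phi D Y = psi D Z'" "Z' \<in> T D m"
      by blast
    have "(\<lambda>v. Z v + Z' v + adj D X (Y v)) \<in> T D m"
      by (rule add_mem[OF add_mem[OF Z(2,4)] comp_mem[OF T_adj[OF XY(1)] XY(2)]])
    moreover have "phi D (\<lambda>v. X v + Y v) = psi D (\<lambda>v. Z v + Z' v + adj D X (Y v))"
      using XY Z by (intro phi_add T_endos) assumption+
    ultimately show ?thesis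
      by blast
  qed
  have comp: "phi D (\<lambda>v. X (Y v)) \<in> psi D ` T D m"
    if XY: "X \<in> T D m" "Y \<in> T D m" and "phi D X \<in> psi D ` T D m" for X Y
  proof -
    from that obtain Z where Z: "phi D X = psi D Z" "Z \<in> T D m"
      by blast
    have "(\<lambda>v. adj D Y (Z (Y v))) \<in> T D m"
      by (rule comp_mem[OF T_adj[OF XY(2)] comp_mem[OF Z(2) XY(2)]])
    moreover have "phi D (\<lambda>v. X (Y v)) = psi D (\<lambda>v. adj D Y (Z (Y v)))"
      using XY Z by (intro phi_comp T_endos) assumption+
    ultimately show ?thesis
      by blast
  qed
  show ?case
  proof (intro conjI ballI)
    fix X Y assume "X \<in> T D (Suc m)" "Y \<in> T D (Suc m)"
    then have X: "X \<in> T D m" "phi D X \<in> psi D ` T D m" "phi D (adj D X) \<in> psi D ` T D m"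
      and Y: "Y \<in> T D m" "phi D Y \<in> psi D ` T D m" "phi D (adj D Y) \<in> psi D ` T D m"
      by auto
    note XY = X(1) Y(1) and e = T_endos[OF X(1)] T_endos[OF Y(1)]
    show "(\<lambda>v. X v + Y v) \<in> T D (Suc m)"
      using add_mem[OF XY] add[OF XY X(2) Y(2)] add[OF T_adj T_adj X(3) Y(3), OF XY]
      by (simp add: adj_add[OF e])
    show "(\<lambda>v. X (Y v)) \<in> T D (Suc m)"
      using comp_mem[OF XY] comp[OF XY X(2)] comp[OF T_adj T_adj Y(3), OF Y(1) X(1)]
      by (simp add: adj_comp[OF e])
  qed
qed

lemma T_add: "X \<in> T D m \<Longrightarrow> Y \<in> T D m \<Longrightarrow> (\<lambda>v. X v + Y v) \<in> T D m"
  and T_comp: "X \<in> T D m \<Longrightarrow> Y \<in> T D m \<Longrightarrow> (\<lambda>v. X (Y v)) \<in> T D m"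
  using T_add_comp[of m] by simp_all

section \<open>Symmetry and integrality of \<open>psi D X\<close> and \<open>phi D X\<close>\<close>

lemma psi_sesquilinear:
  assumes X: "X \<in> endos D" and add: "additive (invol D)"
  shows "sesquilinear D (psi D X)"
proof -
  note Xs = endos_additive[OF X, THEN additive.add] endos_act[OF X]
  note s = additive.add[OF add] additive.minus[OF add]
  show ?thesis
    unfolding sesquilinear_def psi_def additive_def
  proof (intro conjI allI)
    fix v w k l
    show "h (v \<cdot> k) (X (w \<cdot> l)) + h (X (v \<cdot> k)) (w \<cdot> l) =
        invol D k * (h v (X w) + h (X v) w) * l"
      by (simp add: Xs h_act distrib_left distrib_right)
    show "h w (X v) + h (X w) v =
        (if eps D = 1 then invol D (h v (X w) + h (X v) w)
         else - invol D (h v (X w) + h (X v) w))"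
      using h_symmetric[of w "X v"] h_symmetric[of "X w" v] by (simp add: s)
  qed (simp_all add: Xs h_add_left h_add_right)
qed

lemma phi_sesquilinear:
  assumes X: "X \<in> endos D"
  shows "sesquilinear D (phi D X)"
proof -
  note Xs = endos_additive[OF X, THEN additive.add] endos_act[OF X]
  show ?thesis
    unfolding sesquilinear_def phi_def additive_def
    by (intro conjI allI h_symmetric) (simp_all add: Xs h_act h_add_left h_add_right)
qed

text \<open>In the quadratic case \<open>psi D X\<close> comes from q(v) = psi(X)(v, v) = 2 h(v, X
  v), which is integral as soon as 2h is integral on L. The facts about h are hypotheses so that
  they can be supplied over R.\<close>

lemma psi_mem_H0:
  assumes X: "X \<in> T0 D" and add: "additive (invol D)"
    and nonquad: "\<not> quad D \<Longrightarrow> \<forall>v\<in>lat D. \<forall>w\<in>lat D. h v w \<in> maxord D"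
    and quad: "quad D \<Longrightarrow> eps D = 1 \<and> (\<forall>x. invol D x = x) \<and> (\<forall>x y :: 'k. x * y = y * x) \<and>
      (\<forall>v\<in>lat D. \<forall>w\<in>lat D. h v w + h v w \<in> maxord D)"
  shows "psi D X \<in> H0 D"
proof -
  have sesq: "sesquilinear D (psi D X)"
    using X add by (simp add: psi_sesquilinear T0_endos)
  have "hermitian_form D (psi D X)"
  proof (cases "quad D")
    case False
    then show ?thesis
      using sesq nonquad X by (auto simp: hermitian_form_def psi_def T0_lat intro!: maxord_add)
  next
    case True
    note q = quad[OF True]
    then have sym: "h v w = h w v" for v w
      using h_symmetric[of v w] by simp
    have Xadd: "X (v + w) = X v + X w" for v w
      using additive.add[OF endos_additive[OF T0_endos[OF X]]] .
    have "associated D (\<lambda>v. psi D X v v) (psi D X)"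
      unfolding associated_def
    proof (intro conjI ballI)
      fix v assume "v \<in> lat D"
      then have "h v (X v) + h v (X v) \<in> maxord D"
        using q X by (auto simp: T0_lat)
      then show "psi D X v v \<in> maxord D"
        by (simp add: psi_def sym[of "X v" v])
    next
      fix v k
      have "k * x * k = k * k * x" for x :: 'k
        using q by (metis mult.assoc)
      moreover have "psi D X (v \<cdot> k) (v \<cdot> k) = invol D k * psi D X v v * k"
        using sesq[unfolded sesquilinear_def] by blast
      ultimately show "psi D X (v \<cdot> k) (v \<cdot> k) = k * k * psi D X v v"
        using q by (simp add: mult.assoc)
    next
      fix v w
      show "psi D X v w + psi D X v w = psi D X (v + w) (v + w) - psi D X v v - psi D X w w"
        using sym[of "X v" w] sym[of "X w" v]
        by (simp add: psi_def Xadd h_add_left h_add_right algebra_simps)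
    qed
    then show ?thesis
      using sesq True by (auto simp: hermitian_form_def)
  qed
  then show ?thesis
    using X by (auto simp: H0_def psi_def T0_lat T0_dlat h_lat_dlat intro!: maxord_add)
qed

end

section \<open>Hermitian lattices\<close>

locale herm_lattice = local_field val + sesq_space D
  for val :: "'f::field \<Rightarrow> int" and D :: "('k::ring_1, 'v::ab_group_add) herm" +
  fixes \<iota> :: "'f \<Rightarrow> 'k" and n :: nat
  assumes hermitian_lattice: "hermitian_lattice val \<iota> n D"

lemma hermitian_lattice_imp_herm_lattice:
  assumes "hermitian_lattice val \<iota> n D"
  shows "herm_lattice val D \<iota> n"
proof -
  have "nonarch_local_field val" "right_module (act D)" "hermitian_form D (form D)"
    using assms unfolding hermitian_lattice_def by - (elim conjE, assumption)+
  then show ?thesis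
    using assms by unfold_locales (simp_all add: hermitian_form_def)
qed

context herm_lattice
begin

section \<open>The base field inside K and the maximal order\<close>

abbreviation B :: "'k set" where "B \<equiv> maxord D"

lemma iota_one: "\<iota> 1 = 1"
  and iota_add: "\<iota> (a + b) = \<iota> a + \<iota> b"
  and iota_mult: "\<iota> (a * b) = \<iota> a * \<iota> b"
  and iota_central: "\<iota> a * x = x * \<iota> a"
proof -
  have "algebra_map \<iota>"
    using hermitian_lattice by (simp add: hermitian_lattice_def)
  then show "\<iota> 1 = 1" "\<iota> (a + b) = \<iota> a + \<iota> b" "\<iota> (a * b) = \<iota> a * \<iota> b" "\<iota> a * x = x * \<iota> a"
    unfolding algebra_map_def by blast+
qed

lemma additive_iota: "additive \<iota>"
  by (simp add: additive_def iota_add)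

lemmas iota_zero = additive.zero[OF additive_iota]

lemma iota_cancel: "a \<noteq> 0 \<Longrightarrow> \<iota> (1 / a) * (\<iota> a * x) = x"
  using iota_mult[of "1 / a" a] by (simp add: iota_one mult.assoc[symmetric])

lemma act_iota_commute: "v \<cdot> \<iota> a \<cdot> k = v \<cdot> k \<cdot> \<iota> a"
  using act_mult[of v "\<iota> a" k] act_mult[of v k "\<iota> a"] by (simp add: iota_central)

lemma order: "is_order val \<iota> B"
  using hermitian_lattice by (simp add: hermitian_lattice_def maximal_order_def)

lemma one_mem_B: "1 \<in> B"
  and diff_mem_B: "x \<in> B \<Longrightarrow> y \<in> B \<Longrightarrow> x - y \<in> B"
  and mult_mem_B: "x \<in> B \<Longrightarrow> y \<in> B \<Longrightarrow> x * y \<in> B"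
  using order by (auto simp: is_order_def)

lemma zero_mem_B: "0 \<in> B"
  using diff_mem_B[OF one_mem_B one_mem_B] by simp

lemma minus_mem_B: "x \<in> B \<Longrightarrow> - x \<in> B"
  using diff_mem_B[OF zero_mem_B] by fastforce

lemma add_mem_B: "x \<in> B \<Longrightarrow> y \<in> B \<Longrightarrow> x + y \<in> B"
  using diff_mem_B[OF _ minus_mem_B] by fastforce

lemma sum_mem_B: "(\<And>i. i \<in> I \<Longrightarrow> f i \<in> B) \<Longrightarrow> sum f I \<in> B"
  by (induction I rule: infinite_finite_induct) (auto simp: zero_mem_B add_mem_B)

lemma B_generated:
  obtains S where "finite S" "B = {\<Sum>s\<in>S. \<iota> (c s) * s | c. \<forall>s\<in>S. c s \<in> A}"
  using order by (auto simp: is_order_def)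

text \<open>Stability of B under scalars from A is hidden in the finite set of generators; it is
  applied to an expression for 1.\<close>

lemma iota_mem_B: "a \<in> A \<Longrightarrow> \<iota> a \<in> B"
proof -
  assume a: "a \<in> A"
  obtain S where S: "finite S" "B = {\<Sum>s\<in>S. \<iota> (c s) * s | c. \<forall>s\<in>S. c s \<in> A}"
    by (rule B_generated)
  then obtain c where c: "1 = (\<Sum>s\<in>S. \<iota> (c s) * s)" "\<forall>s\<in>S. c s \<in> A"
    using one_mem_B by auto
  have "\<iota> a * 1 = (\<Sum>s\<in>S. \<iota> (a * c s) * s)"
    unfolding c(1) by (simp add: sum_distrib_left iota_mult mult.assoc)
  moreover have "\<forall>s\<in>S. a * c s \<in> A"
    using a c(2) mult_mem_A by blast
  ultimately have "\<exists>c. \<iota> a = (\<Sum>s\<in>S. \<iota> (c s) * s) \<and> (\<forall>s\<in>S. c s \<in> A)"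
    by (intro exI[of _ "\<lambda>s. a * c s"]) simp
  then show ?thesis
    unfolding S(2) by blast
qed

lemma denominator: "\<exists>a\<in>A. a \<noteq> 0 \<and> \<iota> a * x \<in> B"
  using order by (auto simp: is_order_def)

text \<open>This makes h bilinear over F, and it yields the values of the involution at 0 and
  1.\<close>

lemma invol_iota: "invol D (\<iota> a) = \<iota> a"
proof -
  consider "case_base \<iota> (invol D)" | "case_quadratic \<iota> (invol D)"
    | "case_split \<iota> (invol D)" | "case_quaternion \<iota> (invol D)"
    using hermitian_lattice by (auto simp: hermitian_lattice_def)
  then show ?thesis
  proof cases
    case 1
    then show ?thesis by (simp add: case_base_def)
  next
    case 2
    then show ?thesis by (simp add: case_quadratic_def)
  next
    case 3
    then obtain p q where pq: "bij (\<lambda>x. (p x, q x))" "\<forall>a. p (\<iota> a) = a \<and> q (\<iota> a) = a"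
      "\<forall>x. p (invol D x) = q x \<and> q (invol D x) = p x"
      unfolding case_split_def by blast
    then have "(\<lambda>x. (p x, q x)) (invol D (\<iota> a)) = (\<lambda>x. (p x, q x)) (\<iota> a)"
      by simp
    then show ?thesis
      by (rule injD[OF bij_is_inj[OF pq(1)]])
  next
    case 4
    then show ?thesis by (simp add: case_quaternion_def)
  qed
qed

lemma invol_zero: "invol D 0 = 0"
  using invol_iota[of 0] by (simp add: iota_zero)

lemma invol_one: "invol D 1 = 1"
  using invol_iota[of 1] by (simp add: iota_one)

lemma h_iota_left: "h (v \<cdot> \<iota> a) w = \<iota> a * h v w"
  and h_iota_right: "h v (w \<cdot> \<iota> a) = \<iota> a * h v w"
  by (simp_all add: h_act_left h_act_right invol_iota iota_central)

lemma dlat_eq: "dlat D = {x. \<forall>l\<in>lat D. h x l \<in> B}"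
  and lat_eq: "lat D = {x. \<forall>y\<in>dlat D. h x y \<in> B}"
proof -
  have "dlat D = {x. \<forall>l\<in>lat D. h x l \<in> B} \<and> {x. \<forall>y\<in>dlat D. h x y \<in> B} = lat D"
    using hermitian_lattice unfolding hermitian_lattice_def by (elim conjE, intro conjI)
  then show "dlat D = {x. \<forall>l\<in>lat D. h x l \<in> B}" "lat D = {x. \<forall>y\<in>dlat D. h x y \<in> B}"
    by (elim conjE, simp only:)+
qed

lemma h_nondegenerate: "(\<And>w. h v w = 0) \<Longrightarrow> v = 0"
  and vector_denominator: "\<exists>a. a \<noteq> 0 \<and> v \<cdot> \<iota> a \<in> lat D"
proof -
  have "\<forall>v. (\<forall>w. h v w = 0) \<longrightarrow> v = 0" "\<forall>v. \<exists>a\<in>A. a \<noteq> 0 \<and> v \<cdot> \<iota> a \<in> lat D"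
    using hermitian_lattice unfolding hermitian_lattice_def by - (elim conjE, assumption)+
  then show "(\<And>w. h v w = 0) \<Longrightarrow> v = 0" "\<exists>a. a \<noteq> 0 \<and> v \<cdot> \<iota> a \<in> lat D"
    by blast+
qed

lemma lat_basis:
  "\<exists>e. lat D = {\<Sum>i<n. e i \<cdot> k i | k. \<forall>i<n. k i \<in> B} \<and>
     (\<forall>k. (\<forall>i<n. k i \<in> B) \<and> (\<Sum>i<n. e i \<cdot> k i) = 0 \<longrightarrow> (\<forall>i<n. k i = 0))"
  using hermitian_lattice unfolding hermitian_lattice_def
  by (elim conjE exE) (rule exI, rule conjI, assumption+)

lemma vector_space: "vector_space (\<lambda>a v. v \<cdot> \<iota> a)"
  by unfold_locales
    (simp_all add: act_add_left act_add_right iota_add act_mult[symmetric] iota_mult[symmetric]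
      iota_one act_one mult.commute)

text \<open>V is spanned over F by the vectors \<open>e i \<cdot> s\<close>, where \<open>s\<close>
  runs through generators of B over A. The purpose is to deduce surjectivity from
  injectivity.\<close>

lemma finite_dimensional: "\<exists>G. finite_dimensional_vector_space (\<lambda>a v. v \<cdot> \<iota> a) G"
proof -
  interpret vs: vector_space "\<lambda>a v. v \<cdot> \<iota> a"
    by (rule vector_space)
  obtain e where e: "lat D = {\<Sum>i<n. e i \<cdot> k i | k. \<forall>i<n. k i \<in> B}"
    using lat_basis by blast
  obtain S where S: "finite S" "B = {\<Sum>s\<in>S. \<iota> (c s) * s | c. \<forall>s\<in>S. c s \<in> A}"
    by (rule B_generated)
  define G where "G = (\<lambda>(i, s). e i \<cdot> s) ` ({..<n} \<times> S)"
  have lat_span: "v \<in> vs.span G" if "v \<in> lat D" for v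
  proof -
    obtain k where k: "v = (\<Sum>i<n. e i \<cdot> k i)" "\<forall>i<n. k i \<in> B"
      using \<open>v \<in> lat D\<close> e by auto
    have "e i \<cdot> k i \<in> vs.span G" if "i < n" for i
    proof -
      obtain c where c: "k i = (\<Sum>s\<in>S. \<iota> (c s) * s)"
        using k(2) S(2) \<open>i < n\<close> by blast
      have "e i \<cdot> k i = (\<Sum>s\<in>S. e i \<cdot> s \<cdot> \<iota> (c s))"
        by (simp add: c additive.sum[OF additive_act(2)] act_mult act_iota_commute)
      also have "\<dots> \<in> vs.span G"
        using \<open>i < n\<close> by (intro vs.span_sum vs.span_scale vs.span_base) (auto simp: G_def)
      finally show ?thesis .
    qed
    then show ?thesis
      unfolding k(1) by (intro vs.span_sum) auto
  qed
  have span: "vs.span G = UNIV"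
  proof -
    have "v \<in> vs.span G" for v
    proof -
      obtain a where a: "a \<noteq> 0" "v \<cdot> \<iota> a \<in> lat D"
        using vector_denominator by blast
      then have "v \<cdot> \<iota> a \<cdot> \<iota> (1 / a) \<in> vs.span G"
        using lat_span vs.span_scale by blast
      moreover have "v \<cdot> \<iota> a \<cdot> \<iota> (1 / a) = v"
        using a by (simp add: act_mult[symmetric] iota_mult[symmetric] iota_one act_one)
      ultimately show ?thesis
        by simp
    qed
    then show ?thesis
      by auto
  qed
  have "finite G"
    using S by (simp add: G_def)
  obtain G' where G': "G' \<subseteq> G" "vs.independent G'" "G \<subseteq> vs.span G'"
    using vs.maximal_independent_subset[of G] by blast
  have "vs.span G' = UNIV"
    using vs.span_mono[OF G'(3)] span by (auto simp: vs.span_span)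
  then have "finite_dimensional_vector_space (\<lambda>a v. v \<cdot> \<iota> a) G'"
    using G' finite_subset[OF _ \<open>finite G\<close>] by unfold_locales auto
  then show ?thesis
    by blast
qed

text \<open>The map \<open>v \<mapsto> \<Sum> e\<^sub>i h(e\<^sub>i, v)\<close> is \<open>F\<close>-linear and injective, hence surjective; the dual basis
  consists of the preimages of the \<open>e\<^sub>i\<close>.\<close>

lemma dual_bases_exist: "\<exists>e b c. dual_bases D n e b c"
proof -
  obtain e where lat: "lat D = {\<Sum>i<n. e i \<cdot> k i | k. \<forall>i<n. k i \<in> B}"
    and free_B: "\<And>k. \<forall>i<n. k i \<in> B \<Longrightarrow> (\<Sum>i<n. e i \<cdot> k i) = 0 \<Longrightarrow> \<forall>i<n. k i = 0"
    using lat_basis by blast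
  have latI: "(\<Sum>i<n. e i \<cdot> k i) \<in> lat D" if "\<And>i. i < n \<Longrightarrow> k i \<in> B" for k
    unfolding lat using that by blast
  have latD: "\<exists>k. v = (\<Sum>i<n. e i \<cdot> k i) \<and> (\<forall>i<n. k i \<in> B)" if "v \<in> lat D" for v
    using that unfolding lat by blast
  have e_mult: "e i \<cdot> k = (\<Sum>j<n. e j \<cdot> (if j = i then k else 0))" if "i < n" for i k
  proof -
    have "(\<Sum>j<n. e j \<cdot> (if j = i then k else 0)) = (\<Sum>j<n. if j = i then e j \<cdot> k else 0)"
      by (intro sum.cong) (auto simp: additive.zero[OF additive_act(2)])
    then show ?thesis
      using that by simp
  qed
  have e_B: "e i \<cdot> k \<in> lat D" if "i < n" "k \<in> B" for i k
    unfolding e_mult[OF that(1)] using that by (intro latI) (simp add: zero_mem_B)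
  have e_mem: "e i \<in> lat D" if "i < n" for i
    using e_B[OF that one_mem_B] by (simp add: act_one)
  have spans: "\<exists>k. v = (\<Sum>i<n. e i \<cdot> k i)" for v
  proof -
    obtain a where a: "a \<noteq> 0" "v \<cdot> \<iota> a \<in> lat D"
      using vector_denominator by blast
    then obtain k where "v \<cdot> \<iota> a = (\<Sum>i<n. e i \<cdot> k i)"
      using latD by blast
    then have "v \<cdot> \<iota> a \<cdot> \<iota> (1 / a) = (\<Sum>i<n. e i \<cdot> (k i * \<iota> (1 / a)))"
      by (simp add: act_sum_left act_mult)
    moreover have "v \<cdot> \<iota> a \<cdot> \<iota> (1 / a) = v"
      using a by (simp add: act_mult[symmetric] iota_mult[symmetric] iota_one act_one)
    ultimately show ?thesis
      by auto
  qed
  have free: "k i = 0" if "(\<Sum>i<n. e i \<cdot> k i) = 0" "i < n" for k i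
  proof -
    have "\<exists>a. \<forall>i. a i \<in> A \<and> a i \<noteq> 0 \<and> \<iota> (a i) * k i \<in> B"
      using denominator by (intro choice) blast
    then obtain a where a: "\<And>i. a i \<in> A" "\<And>i. a i \<noteq> 0" "\<And>i. \<iota> (a i) * k i \<in> B"
      by blast
    \<comment> \<open>A common denominator turns a relation over K into one over B, where freeness
      is given.\<close>
    define p where "p = (\<Prod>i<n. a i)"
    have mem: "\<iota> p * k i \<in> B" if "i < n" for i
    proof -
      have "p = (\<Prod>j\<in>{..<n} - {i}. a j) * a i"
        using that by (simp add: p_def prod.remove mult.commute)
      then have "\<iota> p * k i = \<iota> (\<Prod>j\<in>{..<n} - {i}. a j) * (\<iota> (a i) * k i)"
        by (simp add: iota_mult mult.assoc)
      also have "\<dots> \<in> B"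
        by (rule mult_mem_B[OF iota_mem_B[OF prod_mem_A[OF a(1)]] a(3)])
      finally show ?thesis .
    qed
    have "(\<Sum>i<n. e i \<cdot> (\<iota> p * k i)) = (\<Sum>i<n. e i \<cdot> k i) \<cdot> \<iota> p"
      by (simp add: act_sum_left act_mult act_iota_commute)
    then have "(\<Sum>i<n. e i \<cdot> (\<iota> p * k i)) = 0"
      unfolding that(1) additive.zero[OF additive_act(1)] .
    then have "\<forall>i<n. \<iota> p * k i = 0"
      using mem by (intro free_B) simp_all
    then have "\<iota> p * k i = 0"
      using that(2) by simp
    moreover have "p \<noteq> 0"
      using a by (simp add: p_def)
    ultimately show ?thesis
      using iota_cancel[of p "k i"] by simp
  qed
  define g where "g v = (\<Sum>i<n. e i \<cdot> h (e i) v)" for v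
  have g_add: "g (v + w) = g v + g w" for v w
    by (simp add: g_def h_add_right act_add_right sum.distrib)
  have g_act: "g (v \<cdot> k) = g v \<cdot> k" for v k
    by (simp add: g_def h_act_right act_mult act_sum_left)
  have g_inj: "inj g"
  proof (rule injI)
    fix v w assume "g v = g w"
    then have "g (v - w) = 0"
      using additive.diff[of g v w] g_add by (simp add: additive_def)
    then have *: "h (e i) (v - w) = 0" if "i < n" for i
      using free[of "\<lambda>i. h (e i) (v - w)"] that by (simp add: g_def)
    have "h (v - w) u = 0" for u
    proof -
      obtain k where "u = (\<Sum>i<n. e i \<cdot> k i)"
        using spans by blast
      then have "h u (v - w) = 0"
        by (simp add: h_sum_left h_act_left *)
      then show ?thesis
        using h_symmetric[of "v - w" u] by (simp add: invol_zero)
    qed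
    then show "v = w"
      using h_nondegenerate[of "v - w"] by simp
  qed
  have "surj g"
  proof -
    obtain G where "finite_dimensional_vector_space (\<lambda>a v. v \<cdot> \<iota> a) G"
      using finite_dimensional by blast
    then interpret vs: finite_dimensional_vector_space "\<lambda>a v. v \<cdot> \<iota> a" G .
    have "Vector_Spaces.linear (\<lambda>a v. v \<cdot> \<iota> a) (\<lambda>a v. v \<cdot> \<iota> a) g"
      using vector_space g_add g_act by (simp add: Vector_Spaces.linear_iff)
    then show ?thesis
      using g_inj by (rule vs.linear_inj_imp_surj)
  qed
  then have "\<forall>j. \<exists>b. g b = e j"
    by (metis surjD)
  then obtain b where b: "\<And>j. g (b j) = e j"
    by metis
  have dual: "h (e i) (b j) = (if i = j then 1 else 0)" if "i < n" "j < n" for i j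
  proof -
    have "(\<Sum>i<n. e i \<cdot> (h (e i) (b j) - (if i = j then 1 else 0))) =
        g (b j) - e j \<cdot> 1"
      unfolding e_mult[OF that(2)] by (simp add: g_def additive.diff[OF additive_act(2)] sum_subtractf)
    also have "\<dots> = 0"
      by (simp add: b act_one)
    finally show ?thesis
      using free[of "\<lambda>i. h (e i) (b j) - (if i = j then 1 else 0)"] that by simp
  qed
  \<comment> \<open>The sign compensates for exchanging the arguments of h.\<close>
  define c where "c i = (if eps D = 1 then b i else - b i)" for i
  have dual_c: "h (c j) (e i) = (if j = i then 1 else 0)" if "i < n" "j < n" for i j
    using h_symmetric[of "b j" "e i"] dual[OF that]
    by (auto simp: c_def invol_one invol_zero additive.minus[OF additive_h(2)])
  have lat_dlat: "h v w \<in> B" if "v \<in> lat D" "w \<in> dlat D" for v w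
    using that by (subst (asm) lat_eq) auto
  have dlat_lat: "h v w \<in> B" if "v \<in> dlat D" "w \<in> lat D" for v w
    using that by (subst (asm) dlat_eq) auto
  have dlatI: "v \<in> dlat D" if "\<And>i. i < n \<Longrightarrow> h v (e i) \<in> B" for v
  proof -
    have "h v l \<in> B" if "l \<in> lat D" for l
    proof -
      obtain k where "l = (\<Sum>i<n. e i \<cdot> k i)" "\<forall>i<n. k i \<in> B"
        using latD[OF \<open>l \<in> lat D\<close>] by blast
      then show ?thesis
        using \<open>\<And>i. i < n \<Longrightarrow> h v (e i) \<in> B\<close>
        by (auto simp: h_sum_right h_act_right intro!: sum_mem_B mult_mem_B)
    qed
    then show ?thesis
      by (simp add: dlat_eq)
  qed
  have b_mem: "b i \<in> dlat D" and c_mem: "c i \<in> dlat D" if "i < n" for i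
  proof -
    show "c i \<in> dlat D"
      using that by (intro dlatI) (simp add: dual_c zero_mem_B one_mem_B)
    have "h (b i) (e j) = (if eps D = 1 then h (c i) (e j) else - h (c i) (e j))" for j
      by (simp add: c_def additive.minus[OF additive_h(2)])
    then show "b i \<in> dlat D"
      using that by (intro dlatI) (auto simp: dual_c zero_mem_B one_mem_B minus_mem_B)
  qed
  \<comment> \<open>Since \<open>e i \<cdot> k\<close> lies in L and \<open>b i\<close> in its dual,
    B contains their pairing, which is the involution of \<open>k\<close>. An index \<open>i\<close>
    must be at hand: in rank 0 there is nothing to pair.\<close>
  have invol_mem: "invol D k \<in> B" if "k \<in> B" "i < n" for k i
  proof -
    have "h (e i \<cdot> k) (b i) \<in> B"
      using that by (intro lat_dlat e_B b_mem)
    then show ?thesis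
      using that by (simp add: h_act_left dual)
  qed
  have "dual_bases D n e b c"
  proof
    fix v
    show "(\<Sum>i<n. b i \<cdot> h (e i) v) = v"
    proof -
      \<comment> \<open>Since \<open>g\<close> sends \<open>b i\<close> to \<open>e i\<close>, it
        sends the expansion to the sum that defines g(v); injectivity removes
        \<open>g\<close>.\<close>
      have "g (\<Sum>i<n. b i \<cdot> h (e i) v) = (\<Sum>i<n. g (b i) \<cdot> h (e i) v)"
        by (simp add: additive.sum[OF additive.intro[OF g_add]] g_act)
      also have "\<dots> = g v"
        by (simp add: b) (simp add: g_def)
      finally show ?thesis
        using g_inj by (simp add: inj_eq)
    qed
    show "(\<Sum>i<n. e i \<cdot> h (c i) v) = v"
    proof -
      obtain k where k: "v = (\<Sum>i<n. e i \<cdot> k i)"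
        using spans by blast
      have "h (c j) v = k j" if "j < n" for j
      proof -
        have "h (c j) v = (\<Sum>i<n. if j = i then k i else 0)"
          unfolding k h_sum_right h_act_right using that
          by (intro sum.cong) (simp_all add: dual_c)
        then show ?thesis
          using that by simp
      qed
      then show ?thesis
        using k by simp
    qed
  next
    fix v w assume v: "v \<in> lat D"
    {
      assume w: "w \<in> lat D"
      \<comment> \<open>L is the dual of its dual, so membership can be tested by pairing.\<close>
      show "v + w \<in> lat D"
        using lat_dlat[OF v] lat_dlat[OF w] by (subst lat_eq) (auto simp: h_add_left add_mem_B)
    }
  next
    fix v k assume v: "v \<in> lat D" and k: "k \<in> B"
    obtain l where "v = (\<Sum>i<n. e i \<cdot> l i)" "\<forall>i<n. l i \<in> B"
      using latD[OF v] by blast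
    then show "v \<cdot> k \<in> lat D"
      using k latI[of "\<lambda>i. l i * k"] by (simp add: act_sum_left act_mult mult_mem_B)
  next
    fix v k assume v: "v \<in> dlat D" and k: "k \<in> B"
    show "v \<cdot> k \<in> dlat D"
    proof (rule dlatI)
      fix i assume "i < n"
      then show "h (v \<cdot> k) (e i) \<in> B"
        using v k by (simp add: h_act_left mult_mem_B invol_mem dlat_lat e_mem)
    qed
  next
    fix v w assume "v \<in> dlat D" "w \<in> dlat D"
    then show "v + w \<in> dlat D"
      by (auto simp: dlat_eq h_add_left add_mem_B)
  next
    show "0 \<in> lat D"
      by (subst lat_eq) (simp add: h_zero_left zero_mem_B)
    show "0 \<in> dlat D"
      by (simp add: dlat_eq h_zero_left zero_mem_B)
  qed (simp_all add: dual e_mem b_mem c_mem add_mem_B lat_dlat dlat_lat)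
  then show ?thesis
    by blast
qed

end

section \<open>Stabilization of the modules \<open>T\<^sup>m(A)\<close>\<close>

locale lattice_with_bases = herm_lattice val D \<iota> n + dual_bases D n e b c
  for val :: "'f::field \<Rightarrow> int" and D :: "('k::ring_1, 'v::ab_group_add) herm"
    and \<iota> n e b c
begin

section \<open>Scaling by A and commensurability of the stages\<close>

lemma endos_scale:
  assumes "X \<in> endos D"
  shows "(\<lambda>v. X v \<cdot> \<iota> a) \<in> endos D"
  using additive.add[OF endos_additive[OF assms]] endos_act[OF assms]
  by (intro endosI) (simp_all add: additive_def act_add_left act_iota_commute)

lemma adj_scale:
  assumes "X \<in> endos D"
  shows "adj D (\<lambda>v. X v \<cdot> \<iota> a) = (\<lambda>v. adj D X v \<cdot> \<iota> a)"
  by (rule adj_eqI[OF endos_scale[OF assms]])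
    (simp only: h_iota_left h_iota_right adj(2)[OF assms])

text \<open>\<open>phi\<close> is quadratic and \<open>psi\<close> is linear, so the witness is
  scaled by the square.\<close>

lemma phi_scale:
  assumes "phi D X = psi D Z"
  shows "phi D (\<lambda>v. X v \<cdot> \<iota> a) = psi D (\<lambda>v. Z v \<cdot> \<iota> (a * a))"
proof (intro ext)
  fix v w
  have "h (X v) (X w) = h v (Z w) + h (Z v) w"
    using fun_cong[OF fun_cong[OF assms]] by (simp add: phi_def psi_def)
  then show "phi D (\<lambda>v. X v \<cdot> \<iota> a) v w = psi D (\<lambda>v. Z v \<cdot> \<iota> (a * a)) v w"
    by (simp only: phi_def psi_def h_iota_left h_iota_right)
      (simp add: iota_mult mult.assoc distrib_left)
qed

lemma T_scale: "X \<in> T D m \<Longrightarrow> a \<in> A \<Longrightarrow> (\<lambda>v. X v \<cdot> \<iota> a) \<in> T D m"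
proof (induction m arbitrary: X a)
  case 0
  then have X: "X \<in> T0 D" by simp
  then have "(\<lambda>v. X v \<cdot> \<iota> a) \<in> T0 D"
    using 0(2)
    by (intro T0I[OF endos_scale[OF T0_endos[OF X]]]) (simp_all add: lat_act dlat_act iota_mem_B T0_lat T0_dlat)
  then show ?case by simp
next
  case (Suc m)
  then have X: "X \<in> T D m" "phi D X \<in> psi D ` T D m" "phi D (adj D X) \<in> psi D ` T D m"
    by auto
  have phi: "phi D (\<lambda>v. Y v \<cdot> \<iota> a) \<in> psi D ` T D m" if Y: "phi D Y \<in> psi D ` T D m" for Y
  proof -
    obtain Z where Z: "phi D Y = psi D Z" "Z \<in> T D m"
      using Y by blast
    show ?thesis
      unfolding phi_scale[OF Z(1)] using Suc Z by (intro imageI Suc.IH mult_mem_A)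
  qed
  show ?case
    using Suc.IH[OF X(1) Suc.prems(2)] phi[OF X(2)] phi[OF X(3)] adj_scale[OF T_endos[OF X(1)]]
    by simp
qed

text \<open>Let phi(a Y) = psi(Z) with Z in stage \<open>m\<close>. Then phi(a^2 Y) = psi(a^2 Z),
  and the induction hypothesis puts a^2 Z into stage \<open>m'\<close>. With one factor
  \<open>a\<close>, the witness Z itself would have to lie in stage \<open>m'\<close>. The second
  factor pays for this anew at every step, so the same square serves all \<open>m'\<close>.\<close>

lemma T_commensurable:
  assumes a: "a \<in> A" and T: "\<And>X. X \<in> T D m \<Longrightarrow> (\<lambda>v. X v \<cdot> \<iota> a) \<in> T D (Suc m)"
    and m': "m \<le> m'" and X: "X \<in> T D m"
  shows "(\<lambda>v. X v \<cdot> \<iota> (a * a)) \<in> T D m'"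
  using m' X
proof (induction m' arbitrary: X rule: dec_induct)
  case base
  then show ?case
    using a by (intro T_scale mult_mem_A)
next
  case (step m')
  have phi: "phi D (\<lambda>v. Y v \<cdot> \<iota> (a * a)) \<in> psi D ` T D m'" if Y: "Y \<in> T D m" for Y
  proof -
    obtain Z where Z: "phi D (\<lambda>v. Y v \<cdot> \<iota> a) = psi D Z" "Z \<in> T D m"
      using T[OF Y] by auto
    have "phi D (\<lambda>v. Y v \<cdot> \<iota> (a * a)) = phi D (\<lambda>v. Y v \<cdot> \<iota> a \<cdot> \<iota> a)"
      by (simp add: iota_mult act_mult)
    then show ?thesis
      unfolding phi_scale[OF Z(1)] using step Z by auto
  qed
  show ?case
    using step phi[OF step.prems] phi[OF T_adj[OF step.prems]] adj_scale[OF T_endos[OF step.prems]]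
    by simp
qed

text \<open>By its matrix entries, expanded in generators of B, an element of T^0(A) is an
  A-combination of finitely many fixed endomorphisms of V. The stages are replaced by their full
  preimages in A^k. Coefficients may be ambiguous, but each stage is recovered as the image of its
  preimage.\<close>

lemma T_stabilizes: "\<exists>m0. \<forall>m\<ge>m0. T D m = T D m0"
proof -
  obtain S where S: "finite S" "B = {\<Sum>s\<in>S. \<iota> (c s) * s | c. \<forall>s\<in>S. c s \<in> A}"
    by (rule B_generated)
  define J where "J = {..<n} \<times> {..<n} \<times> S"
  define k where "k = card J"
  have "finite J"
    using S(1) by (simp add: J_def)
  then obtain f where f: "bij_betw f {..<k} J"
    using ex_bij_betw_nat_finite[of J] by (auto simp: k_def atLeast0LessThan)
  \<comment> \<open>The matrix with the single entry \<open>s\<close> in row \<open>l\<close> and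
    column \<open>i\<close>: \<open>h (c i) v\<close> is the coordinate of \<open>v\<close> at
    \<open>e i\<close>.\<close>
  define gen where "gen = (\<lambda>(i, l, s) v. e l \<cdot> s \<cdot> h (c i) v)"
  define comb where "comb a v = (\<Sum>q<k. gen (f q) v \<cdot> \<iota> (a q))" for a v
  define C where "C m = {a. (\<forall>q<k. a q \<in> A) \<and> (\<forall>q\<ge>k. a q = 0) \<and> comb a \<in> T D m}" for m
  have comb_scale: "comb (\<lambda>i. d * a i) = (\<lambda>v. comb a v \<cdot> \<iota> d)" for a d
    by (simp add: comb_def fun_eq_iff act_sum_left act_mult[symmetric] iota_mult[symmetric]
        mult.commute)
  have comb_diff: "comb (\<lambda>i. a i - a' i) = (\<lambda>v. comb a v + comb a' v \<cdot> \<iota> (- 1))" for a a'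
  proof
    fix v
    have "comb a' v \<cdot> \<iota> (- 1) = comb (\<lambda>i. - 1 * a' i) v"
      by (simp only: comb_scale)
    then show "comb (\<lambda>i. a i - a' i) v = comb a v + comb a' v \<cdot> \<iota> (- 1)"
      by (simp add: comb_def act_add_right[symmetric] iota_add[symmetric] sum.distrib[symmetric])
  qed
  have comb_zero: "comb (\<lambda>_. 0) = (\<lambda>_. 0)"
    by (rule ext) (simp add: comb_def iota_zero additive.zero[OF additive_act(2)])
  have comb_surj: "\<exists>a. (\<forall>q<k. a q \<in> A) \<and> (\<forall>q\<ge>k. a q = 0) \<and> comb a = X" if X: "X \<in> T0 D" for X
  proof -
    have "\<exists>r. h (c l) (X (e i)) = (\<Sum>s\<in>S. \<iota> (r s) * s) \<and> (\<forall>s\<in>S. r s \<in> A)"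
      if "i < n" "l < n" for i l
    proof -
      have "h (c l) (X (e i)) \<in> B"
        using that by (intro h_dlat_lat c_mem T0_lat[OF X] e_mem)
      then show ?thesis
        unfolding S(2) by blast
    qed
    then obtain r where r: "\<And>i l. i < n \<Longrightarrow> l < n \<Longrightarrow>
        h (c l) (X (e i)) = (\<Sum>s\<in>S. \<iota> (r i l s) * s) \<and> (\<forall>s\<in>S. r i l s \<in> A)"
      by metis
    define a where "a q = (if q < k then (\<lambda>(i, l, s). r i l s) (f q) else 0)" for q
    have "a q \<in> A" if "q < k" for q
    proof -
      have "f q \<in> J"
        using bij_betwE[OF f] that by blast
      then show ?thesis
        using r that by (auto simp: a_def J_def)
    qed
    moreover have "comb a = X"
    proof
      fix v
      have "comb a v = (\<Sum>q<k. (\<lambda>(i, l, s). gen (i, l, s) v \<cdot> \<iota> (r i l s)) (f q))"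
        unfolding comb_def by (intro sum.cong) (auto simp: a_def split: prod.splits)
      also have "\<dots> = (\<Sum>(i, l, s)\<in>J. gen (i, l, s) v \<cdot> \<iota> (r i l s))"
        by (rule sum.reindex_bij_betw[OF f])
      also have "\<dots> = (\<Sum>i<n. \<Sum>l<n. \<Sum>s\<in>S. e l \<cdot> s \<cdot> h (c i) v \<cdot> \<iota> (r i l s))"
        by (simp add: J_def gen_def sum.cartesian_product[symmetric])
      also have "\<dots> = (\<Sum>i<n. (\<Sum>l<n. e l \<cdot> h (c l) (X (e i))) \<cdot> h (c i) v)"
      proof -
        have "(\<Sum>s\<in>S. e l \<cdot> s \<cdot> h (c i) v \<cdot> \<iota> (r i l s)) = e l \<cdot> h (c l) (X (e i)) \<cdot> h (c i) v"
          if "i < n" "l < n" for i l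
          using r[OF that] by (simp add: additive.sum[OF additive_act(2)] act_sum_left act_mult
              act_iota_commute)
        then show ?thesis
          by (simp add: act_sum_left)
      qed
      also have "\<dots> = (\<Sum>i<n. X (e i) \<cdot> h (c i) v)"
        by (simp only: expand_e)
      also have "\<dots> = X (\<Sum>i<n. e i \<cdot> h (c i) v)"
        by (simp only: additive.sum[OF endos_additive[OF T0_endos[OF X]]] endos_act[OF T0_endos[OF X]])
      finally show "comb a v = X v"
        by (simp only: expand_e)
    qed
    moreover have "\<forall>q\<ge>k. a q = 0"
      by (simp add: a_def)
    ultimately show ?thesis
      by blast
  qed
  have T_eq: "T D m = comb ` C m" for m
  proof
    show "T D m \<subseteq> comb ` C m"
    proof
      fix X assume X: "X \<in> T D m"
      then have "X \<in> T0 D"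
        using T_antimono[of 0 m] by auto
      with X show "X \<in> comb ` C m"
        using comb_surj[of X] unfolding C_def by blast
    qed
  qed (auto simp only: C_def)
  have "\<exists>m0. \<forall>m\<ge>m0. C m = C m0"
  proof (rule submodule_chain_stabilizes)
    show "submodule k (C m)" for m
      using T_zero T_scale T_add minus_mem_A[OF one_mem_A]
      by (auto simp: submodule_def C_def zero_mem_A comb_zero comb_scale comb_diff mult_mem_A diff_mem_A)
    show "C (Suc m) \<subseteq> C m" for m
      by (auto simp: C_def)
    fix m d assume d: "d \<in> A" "d \<noteq> 0" "\<forall>x\<in>C m. (\<lambda>i. d * x i) \<in> C (Suc m)"
    have T: "(\<lambda>v. X v \<cdot> \<iota> d) \<in> T D (Suc m)" if "X \<in> T D m" for X
    proof -
      from that[unfolded T_eq] obtain a where a: "a \<in> C m" "X = comb a"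
        by blast
      then have "(\<lambda>i. d * a i) \<in> C (Suc m)"
        using d(3) by blast
      then have "comb (\<lambda>i. d * a i) \<in> T D (Suc m)"
        unfolding C_def by blast
      then show ?thesis
        unfolding comb_scale a(2) .
    qed
    \<comment> \<open>The uniformity demanded by the chain lemma: one constant for all later
      stages.\<close>
    have "(\<lambda>i. d * d * x i) \<in> C m'" if "m \<le> m'" "x \<in> C m" for m' x
      using T_commensurable[OF d(1) T that(1), of "comb x"] that(2) d(1)
      unfolding C_def mem_Collect_eq comb_scale by (auto intro: mult_mem_A)
    then show "\<exists>d\<in>A. d \<noteq> 0 \<and> (\<forall>m'\<ge>m. \<forall>x\<in>C m. (\<lambda>i. d * x i) \<in> C m')"
      using d by (intro bexI[of _ "d * d"]) (auto intro: mult_mem_A)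
  qed
  then show ?thesis
    unfolding T_eq by metis
qed

lemma T_alpha: "m \<ge> alpha D \<Longrightarrow> T D m = T D (alpha D)"
  using LeastI_ex[OF T_stabilizes] unfolding alpha_def by blast

text \<open>The stage after \<open>alpha D\<close> is the same set, and membership in it provides a
  witness that lies in stage \<open>alpha D\<close> itself.\<close>

lemma phi_T_alpha: "X \<in> T D (alpha D) \<Longrightarrow> phi D X \<in> psi D ` T D (alpha D)"
  using T_alpha[of "Suc (alpha D)"] by auto

end

section \<open>Tensor products\<close>

text \<open>The left factor is left open because both K and V are tensored with R; \<open>Z\<close>
  will be A.\<close>

locale tensor =
  fixes Z :: "('f, 'c) ring_scheme" and R :: "('f, 'r) module"
    and sc :: "'f \<Rightarrow> 'm::ab_group_add \<Rightarrow> 'm" and tau :: "'m \<Rightarrow> 'r \<Rightarrow> 'p::ab_group_add"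
  assumes algebra: "algebra Z R"
    and tensor_product: "tensor_product Z (as_module sc) R tau"
begin

sublocale R: cring R
  using algebra by (simp add: algebra_def)

lemma as_module_simps [simp]:
  "carrier (as_module sc) = UNIV" "\<zero>\<^bsub>as_module sc\<^esub> = 0"
  "x \<oplus>\<^bsub>as_module sc\<^esub> y = x + y" "a \<odot>\<^bsub>as_module sc\<^esub> x = sc a x"
  by (simp_all add: as_module_def)

lemma smult_closed: "a \<in> carrier Z \<Longrightarrow> r \<in> carrier R \<Longrightarrow> a \<odot>\<^bsub>R\<^esub> r \<in> carrier R"
  and smult_mult_assoc: "a \<in> carrier Z \<Longrightarrow> r \<in> carrier R \<Longrightarrow> s \<in> carrier R \<Longrightarrow>
    (a \<odot>\<^bsub>R\<^esub> r) \<otimes>\<^bsub>R\<^esub> s = a \<odot>\<^bsub>R\<^esub> (r \<otimes>\<^bsub>R\<^esub> s)"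
  using algebra module.smult_closed[of Z R] algebra.smult_assoc2[of Z R]
  by (auto simp: algebra_def)

lemma tau_eq_iff:
  assumes "set_mset s \<subseteq> UNIV \<times> carrier R" "set_mset t \<subseteq> UNIV \<times> carrier R"
  shows "(\<Sum>(x, r)\<in>#s. tau x r) = (\<Sum>(x, r)\<in>#t. tau x r) \<longleftrightarrow> tensor_eq Z (as_module sc) R s t"
  using tensor_product assms by (simp add: tensor_product_def)

lemmas tau_eqI = tau_eq_iff[THEN iffD2, rotated 2]

lemma tau_add_left: "r \<in> carrier R \<Longrightarrow> tau (x + y) r = tau x r + tau y r"
  using tau_eqI[OF tensor_eq.left[of x "as_module sc" y r R Z]] by simp

lemma tau_add_right:
  "r \<in> carrier R \<Longrightarrow> s \<in> carrier R \<Longrightarrow> tau x (r \<oplus>\<^bsub>R\<^esub> s) = tau x r + tau x s"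
  using tau_eqI[OF tensor_eq.right[of x "as_module sc" r R s Z]] by simp

lemma tau_balanced:
  "a \<in> carrier Z \<Longrightarrow> r \<in> carrier R \<Longrightarrow> tau (sc a x) r = tau x (a \<odot>\<^bsub>R\<^esub> r)"
  using tau_eqI[OF tensor_eq.balanced[of a Z x "as_module sc" r R]] by (simp add: smult_closed)

lemma additive_tau: "r \<in> carrier R \<Longrightarrow> additive (\<lambda>x. tau x r)"
  by (simp add: additive_def tau_add_left)

lemmas tau_zero = additive.zero[OF additive_tau]
lemmas tau_minus = additive.minus[OF additive_tau]
lemmas tau_sum = additive.sum[OF additive_tau]

lemma tensor_rep: "\<exists>s. set_mset s \<subseteq> UNIV \<times> carrier R \<and> u = (\<Sum>(x, r)\<in>#s. tau x r)"
  using tensor_product by (simp add: tensor_product_def)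

text \<open>The zero tensor is covered by the first case, being the elementary tensor of two
  zeros.\<close>

lemma tensor_induct [case_names tau add]:
  assumes tau: "\<And>x r. r \<in> carrier R \<Longrightarrow> P (tau x r)"
    and add: "\<And>u w. P u \<Longrightarrow> P w \<Longrightarrow> P (u + w)"
  shows "P u"
proof -
  obtain s where s: "set_mset s \<subseteq> UNIV \<times> carrier R" "u = (\<Sum>(x, r)\<in>#s. tau x r)"
    using tensor_rep by blast
  have "P 0"
    using tau[of "\<zero>\<^bsub>R\<^esub>" 0] by (simp add: tau_zero)
  then have "P (\<Sum>(x, r)\<in>#s. tau x r)"
    using s(1) by (induction s) (auto intro: tau add)
  then show ?thesis
    by (simp add: s(2))
qed

lemma additive_eqI:
  assumes "additive f" "additive g" "\<And>x r. r \<in> carrier R \<Longrightarrow> f (tau x r) = g (tau x r)"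
  shows "f = g"
proof
  fix u
  show "f u = g u"
    by (induction u rule: tensor_induct)
      (simp_all add: assms(3) additive.add[OF assms(1)] additive.add[OF assms(2)])
qed

text \<open>The universal property. The map is summed over a formal sum that represents the
  argument, and rule induction on \<open>tensor_eq\<close> shows independence of the representative.
  It justifies the definite descriptions in \<open>end_tensor\<close> and
  \<open>tensor_map\<close>.\<close>

lemma lift_exists:
  fixes \<beta> :: "'m \<Rightarrow> 'r \<Rightarrow> 'q::ab_group_add"
  assumes left: "\<And>x y r. r \<in> carrier R \<Longrightarrow> \<beta> (x + y) r = \<beta> x r + \<beta> y r"
    and right: "\<And>x r s. r \<in> carrier R \<Longrightarrow> s \<in> carrier R \<Longrightarrow> \<beta> x (r \<oplus>\<^bsub>R\<^esub> s) = \<beta> x r + \<beta> x s"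
    and balanced: "\<And>a x r. a \<in> carrier Z \<Longrightarrow> r \<in> carrier R \<Longrightarrow> \<beta> (sc a x) r = \<beta> x (a \<odot>\<^bsub>R\<^esub> r)"
  shows "\<exists>!f. additive f \<and> (\<forall>x. \<forall>r\<in>carrier R. f (tau x r) = \<beta> x r)"
proof -
  define total where "total s = (\<Sum>(x, r)\<in>#s. \<beta> x r)" for s
  have zero: "\<beta> 0 r = 0" if "r \<in> carrier R" for r
    using left[OF that, of 0 0] by simp
  have total_eq: "total s = total t" if "tensor_eq Z (as_module sc) R s t" for s t
    using that
    by (induction rule: tensor_eq.induct) (simp_all add: total_def zero left right balanced)
  define s where "s u = (SOME s. set_mset s \<subseteq> UNIV \<times> carrier R \<and> u = (\<Sum>(x, r)\<in>#s. tau x r))" for u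
  have s: "set_mset (s u) \<subseteq> UNIV \<times> carrier R" "(\<Sum>(x, r)\<in>#s u. tau x r) = u" for u
    using someI_ex[OF tensor_rep[of u]] by (simp_all add: s_def)
  have total_s: "total (s (\<Sum>(x, r)\<in>#t. tau x r)) = total t"
    if "set_mset t \<subseteq> UNIV \<times> carrier R" for t
    by (rule total_eq, rule tau_eq_iff[THEN iffD1, OF s(1) that s(2)])
  define f where "f u = total (s u)" for u
  have f: "f (tau x r) = \<beta> x r" if "r \<in> carrier R" for x r
    using total_s[of "{#(x, r)#}"] that by (simp add: f_def total_def)
  have "f (u + w) = f u + f w" for u w
    using total_s[of "s u + s w"] s[of u] s[of w] by (simp add: f_def total_def)
  then have "additive f"
    by (simp add: additive_def)
  then show ?thesis
    using f by (intro ex1I[of _ f] conjI additive_eqI) auto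
qed

lemma mem_extend_set: "x \<in> S \<Longrightarrow> r \<in> carrier R \<Longrightarrow> tau x r \<in> extend_set R tau S"
  unfolding extend_set_def by (intro CollectI exI[of _ "{#(x, r)#}"]) simp

lemma zero_mem_extend_set: "0 \<in> extend_set R tau S"
  unfolding extend_set_def by (intro CollectI exI[of _ "{#}"]) simp

lemma add_mem_extend_set:
  "u \<in> extend_set R tau S \<Longrightarrow> w \<in> extend_set R tau S \<Longrightarrow> u + w \<in> extend_set R tau S"
  unfolding extend_set_def
proof clarify
  fix s t assume "set_mset s \<subseteq> S \<times> carrier R" "set_mset t \<subseteq> S \<times> carrier R"
  then show "\<exists>s'. (\<Sum>(x, r)\<in>#s. tau x r) + (\<Sum>(x, r)\<in>#t. tau x r) = (\<Sum>(x, r)\<in>#s'. tau x r) \<and>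
      set_mset s' \<subseteq> S \<times> carrier R"
    by (intro exI[of _ "s + t"]) simp
qed

text \<open>In contrast to the whole tensor product, 0 is a case of its own, because
  \<open>S\<close> is an arbitrary set.\<close>

lemma extend_set_induct [consumes 1, case_names zero tau add]:
  assumes "u \<in> extend_set R tau S" and zero: "P 0"
    and tau: "\<And>x r. x \<in> S \<Longrightarrow> r \<in> carrier R \<Longrightarrow> P (tau x r)"
    and add: "\<And>u w. P u \<Longrightarrow> P w \<Longrightarrow> P (u + w)"
  shows "P u"
proof -
  obtain s where "set_mset s \<subseteq> S \<times> carrier R" "u = (\<Sum>(x, r)\<in>#s. tau x r)"
    using assms(1) by (auto simp: extend_set_def)
  moreover from this(1) have "P (\<Sum>(x, r)\<in>#s. tau x r)"
    by (induction s) (auto intro: zero tau add)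
  ultimately show ?thesis
    by simp
qed

end

section \<open>Extension of scalars\<close>

locale scalar_ext = lattice_with_bases val D \<iota> n e b c
  for val :: "'f::field \<Rightarrow> int" and D :: "('k::ring_1, 'v::ab_group_add) herm"
    and \<iota> n e b c +
  fixes R :: "('f, 'r) module"
    and E :: "('k, 'v, 'r, 'kr::{ring,monoid_mult}, 'vr::ab_group_add) extension"
  assumes alg: "algebra (int_ring val) R"
    and scalar_extension: "scalar_extension val \<iota> D R E"
begin

lemma tensor_facts:
  "tensor_product (int_ring val) (as_module (\<lambda>a x. \<iota> a * x)) R (tK E)"
  "tensor_product (int_ring val) (as_module (\<lambda>a v. v \<cdot> \<iota> a)) R (tV E)"
  "tK E 1 \<one>\<^bsub>R\<^esub> = 1"
  "\<forall>x y. \<forall>r\<in>carrier R. \<forall>s\<in>carrier R. tK E x r * tK E y s = tK E (x * y) (r \<otimes>\<^bsub>R\<^esub> s)"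
  "right_module (act (dat E))"
  "\<forall>v x. \<forall>r\<in>carrier R. \<forall>s\<in>carrier R.
     act (dat E) (tV E v r) (tK E x s) = tV E (v \<cdot> x) (r \<otimes>\<^bsub>R\<^esub> s)"
  "additive (invol (dat E))"
  "\<forall>x. \<forall>r\<in>carrier R. invol (dat E) (tK E x r) = tK E (invol D x) r"
  "maxord (dat E) = extend_set R (tK E) B"
  "lat (dat E) = extend_set R (tV E) (lat D)"
  "dlat (dat E) = extend_set R (tV E) (dlat D)"
  "\<forall>u. additive (form (dat E) u)" "\<forall>u. additive (\<lambda>t. form (dat E) t u)"
  "\<forall>v w. \<forall>r\<in>carrier R. \<forall>s\<in>carrier R.
     form (dat E) (tV E v r) (tV E w s) = tK E (h v w) (r \<otimes>\<^bsub>R\<^esub> s)"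
  "eps (dat E) = eps D" "quad (dat E) = quad D"
  using scalar_extension unfolding scalar_extension_def by - (elim conjE, assumption)+

sublocale K: tensor "int_ring val" R "\<lambda>a x. \<iota> a * x" "tK E"
  by (rule tensor.intro[OF alg tensor_facts(1)])

sublocale V: tensor "int_ring val" R "\<lambda>a v. v \<cdot> \<iota> a" "tV E"
  by (rule tensor.intro[OF alg tensor_facts(2)])

lemma tK_mult: "r \<in> carrier R \<Longrightarrow> s \<in> carrier R \<Longrightarrow> tK E x r * tK E y s = tK E (x * y) (r \<otimes>\<^bsub>R\<^esub> s)"
  and act_tensor: "r \<in> carrier R \<Longrightarrow> s \<in> carrier R \<Longrightarrow>
    act (dat E) (tV E v r) (tK E x s) = tV E (v \<cdot> x) (r \<otimes>\<^bsub>R\<^esub> s)"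
  and invol_tensor: "r \<in> carrier R \<Longrightarrow> invol (dat E) (tK E x r) = tK E (invol D x) r"
  and form_tensor: "r \<in> carrier R \<Longrightarrow> s \<in> carrier R \<Longrightarrow>
    form (dat E) (tV E v r) (tV E w s) = tK E (h v w) (r \<otimes>\<^bsub>R\<^esub> s)"
  using tensor_facts(4,6,8,14) by simp_all

lemmas invol_add = additive.add[OF tensor_facts(7)]
lemmas form_add_right = additive.add[OF tensor_facts(12)[rule_format]]
lemmas form_add_left = additive.add[OF tensor_facts(13)[rule_format]]
lemmas form_zero_right = additive.zero[OF tensor_facts(12)[rule_format]]
lemmas form_zero_left = additive.zero[OF tensor_facts(13)[rule_format]]

lemma act_ext_add: "act (dat E) (u + w) k = act (dat E) u k + act (dat E) w k"
  "act (dat E) u (k + l) = act (dat E) u k + act (dat E) u l"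
  using tensor_facts(5) by (simp_all add: right_module_def)

text \<open>Additivity reduces all four arguments to elementary tensors, where the identity is the
  one over K together with commutativity of R.\<close>

lemma form_ext_act:
  "form (dat E) (act (dat E) u k) (act (dat E) w l) = invol (dat E) k * form (dat E) u w * l"
proof (induction u rule: V.tensor_induct)
  case (tau v r)
  show ?case
  proof (induction w rule: V.tensor_induct)
    case (tau w s)
    show ?case
    proof (induction k rule: K.tensor_induct)
      case (tau k r')
      show ?case
      proof (induction l rule: K.tensor_induct)
        case (tau l s')
        have "(r \<otimes>\<^bsub>R\<^esub> r') \<otimes>\<^bsub>R\<^esub> (s \<otimes>\<^bsub>R\<^esub> s') = r' \<otimes>\<^bsub>R\<^esub> (r \<otimes>\<^bsub>R\<^esub> s) \<otimes>\<^bsub>R\<^esub> s'"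
          using \<open>r \<in> _\<close> \<open>s \<in> _\<close> \<open>r' \<in> _\<close> \<open>s' \<in> _\<close> by (simp add: K.R.m_ac)
        then show ?case
          using \<open>r \<in> _\<close> \<open>s \<in> _\<close> \<open>r' \<in> _\<close> \<open>s' \<in> _\<close>
          by (simp add: act_tensor form_tensor invol_tensor tK_mult h_act)
      qed (simp add: act_ext_add form_add_right distrib_left)
    qed (simp add: act_ext_add form_add_left invol_add distrib_right)
  qed (simp add: act_ext_add form_add_right distrib_left distrib_right)
qed (simp add: act_ext_add form_add_left distrib_left distrib_right)

lemma form_ext_symmetric:
  "form (dat E) w u = (if eps (dat E) = 1 then invol (dat E) (form (dat E) u w)
    else - invol (dat E) (form (dat E) u w))"
proof (induction u rule: V.tensor_induct)
  case (tau v r)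
  show ?case
  proof (induction w rule: V.tensor_induct)
    case (tau w s)
    show ?case
      using \<open>r \<in> _\<close> \<open>s \<in> _\<close> h_symmetric[of w v]
      by (simp add: form_tensor invol_tensor tensor_facts(15) K.tau_minus K.R.m_comm[of r s])
  qed (simp add: form_add_left form_add_right invol_add)
qed (simp add: form_add_left form_add_right invol_add)

lemma ext_sesq_space: "sesq_space (dat E)"
  using tensor_facts(5,12,13) form_ext_act form_ext_symmetric
  unfolding sesq_space_def sesquilinear_def by blast

text \<open>The families are those over A, tensored with 1. On v \<otimes> r each expansion becomes
  the expansion of v, tensored with r; statements about the lattices reduce to elementary tensors in
  the same way.\<close>

lemma ext_dual_bases:
  "dual_bases (dat E) n (\<lambda>i. tV E (e i) \<one>\<^bsub>R\<^esub>) (\<lambda>i. tV E (b i) \<one>\<^bsub>R\<^esub>) (\<lambda>i. tV E (c i) \<one>\<^bsub>R\<^esub>)"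
proof -
  interpret X: sesq_space "dat E"
    by (rule ext_sesq_space)
  note L = tensor_facts(9-11)
  have expand: "(\<Sum>i<n. act (dat E) (tV E (x i) \<one>\<^bsub>R\<^esub>) (form (dat E) (tV E (y i) \<one>\<^bsub>R\<^esub>) u)) = u"
    if "\<And>v. (\<Sum>i<n. x i \<cdot> h (y i) v) = v" for x y u
  proof (induction u rule: V.tensor_induct)
    case (tau v r)
    have "(\<Sum>i<n. act (dat E) (tV E (x i) \<one>\<^bsub>R\<^esub>) (form (dat E) (tV E (y i) \<one>\<^bsub>R\<^esub>) (tV E v r))) =
        (\<Sum>i<n. tV E (x i \<cdot> h (y i) v) r)"
      using tau by (simp add: form_tensor act_tensor)
    also have "\<dots> = tV E v r"
      using that tau by (simp add: V.tau_sum[symmetric])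
    finally show ?case .
  qed (simp add: form_add_right act_ext_add sum.distrib)
  show ?thesis
  proof
    show "form (dat E) (tV E (e i) \<one>\<^bsub>R\<^esub>) (tV E (b j) \<one>\<^bsub>R\<^esub>) = (if i = j then 1 else 0)"
      if "i < n" "j < n" for i j
      using that by (simp add: form_tensor h_dual tensor_facts(3) K.tau_zero)
    show "v + w \<in> lat (dat E)" if "v \<in> lat (dat E)" "w \<in> lat (dat E)" for v w
      using that unfolding L by (rule V.add_mem_extend_set)
    show "v + w \<in> dlat (dat E)" if "v \<in> dlat (dat E)" "w \<in> dlat (dat E)" for v w
      using that unfolding L by (rule V.add_mem_extend_set)
    show "v + w \<in> maxord (dat E)" if "v \<in> maxord (dat E)" "w \<in> maxord (dat E)" for v w
      using that unfolding L by (rule K.add_mem_extend_set)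
    have act: "act (dat E) v k \<in> extend_set R (tV E) S"
      if "v \<in> extend_set R (tV E) S" "k \<in> extend_set R (tK E) B"
        and S: "\<And>v k. v \<in> S \<Longrightarrow> k \<in> B \<Longrightarrow> v \<cdot> k \<in> S" for v k S
      using that(1)
    proof (induction v rule: V.extend_set_induct)
      case (tau v r)
      show ?case
        using that(2)
      proof (induction k rule: K.extend_set_induct)
        case (tau k s)
        then show ?case
          using \<open>v \<in> S\<close> \<open>r \<in> _\<close> by (simp add: act_tensor V.mem_extend_set S)
      qed (simp_all add: X.act_add_right V.add_mem_extend_set V.zero_mem_extend_set
          additive.zero[OF X.additive_act(2)])
    qed (simp_all add: X.act_add_left V.add_mem_extend_set V.zero_mem_extend_set
        additive.zero[OF X.additive_act(1)])
    show "act (dat E) v k \<in> lat (dat E)" if "v \<in> lat (dat E)" "k \<in> maxord (dat E)" for v k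
      using that lat_act unfolding L by (rule act)
    show "act (dat E) v k \<in> dlat (dat E)" if "v \<in> dlat (dat E)" "k \<in> maxord (dat E)" for v k
      using that dlat_act unfolding L by (rule act)
    have form: "form (dat E) v w \<in> extend_set R (tK E) B"
      if "v \<in> extend_set R (tV E) S" "w \<in> extend_set R (tV E) S'"
        and S: "\<And>v w. v \<in> S \<Longrightarrow> w \<in> S' \<Longrightarrow> h v w \<in> B" for v w S S'
      using that(1)
    proof (induction v rule: V.extend_set_induct)
      case (tau v r)
      show ?case
        using that(2)
      proof (induction w rule: V.extend_set_induct)
        case (tau w s)
        then show ?case
          using \<open>v \<in> S\<close> \<open>r \<in> _\<close> by (simp add: form_tensor K.mem_extend_set S)
      qed (simp_all add: form_add_right form_zero_right K.add_mem_extend_set K.zero_mem_extend_set)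
    qed (simp_all add: form_add_left form_zero_left K.add_mem_extend_set K.zero_mem_extend_set)
    show "form (dat E) v w \<in> maxord (dat E)" if "v \<in> lat (dat E)" "w \<in> dlat (dat E)" for v w
      using that h_lat_dlat unfolding L by (rule form)
    show "form (dat E) v w \<in> maxord (dat E)" if "v \<in> dlat (dat E)" "w \<in> lat (dat E)" for v w
      using that h_dlat_lat unfolding L by (rule form)
  qed (simp_all add: expand expand_b expand_e L V.zero_mem_extend_set V.mem_extend_set e_mem b_mem c_mem)
qed

sublocale ext: dual_bases "dat E" n "\<lambda>i. tV E (e i) \<one>\<^bsub>R\<^esub>" "\<lambda>i. tV E (b i) \<one>\<^bsub>R\<^esub>" "\<lambda>i. tV E (c i) \<one>\<^bsub>R\<^esub>"
  by (rule ext_dual_bases)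

end

lemma (in lattice_with_bases) scalar_extI:
  "flat_algebra val R \<Longrightarrow> scalar_extension val \<iota> D R E \<Longrightarrow> scalar_ext val D \<iota> n e b c R E"
  by (simp add: scalar_ext_def scalar_ext_axioms_def flat_algebra_def lattice_with_bases_axioms)

context scalar_ext
begin

text \<open>These are the facts over A behind the hypotheses of \<open>psi_mem_H0\<close>. In the
  quadratic case 2h is the polar form of an integral q, so integrality is available for 2h.\<close>

lemma lat_form_nonquad: "\<not> quad D \<Longrightarrow> v \<in> lat D \<Longrightarrow> w \<in> lat D \<Longrightarrow> h v w \<in> B"
  and quad_facts: "quad D \<Longrightarrow> surj \<iota> \<and> invol D = id \<and> eps D = 1"
  and quad_double: "quad D \<Longrightarrow> v \<in> lat D \<Longrightarrow> w \<in> lat D \<Longrightarrow> h v w + h v w \<in> B"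
proof -
  have "hermitian_form D h"
    and quad: "quad D \<longleftrightarrow> case_base \<iota> (invol D) \<and> eps D = 1 \<and> residue_char val = 2"
    using hermitian_lattice unfolding hermitian_lattice_def by - (elim conjE, assumption)+
  then have form: "if quad D then \<exists>q. associated D q h else \<forall>v\<in>lat D. \<forall>w\<in>lat D. h v w \<in> B"
    by (simp add: hermitian_form_def)
  show "h v w \<in> B" if "\<not> quad D" "v \<in> lat D" "w \<in> lat D"
    using form that by simp
  show "surj \<iota> \<and> invol D = id \<and> eps D = 1" if "quad D"
    using quad that by (simp add: case_base_def)
  show "h v w + h v w \<in> B" if "quad D" "v \<in> lat D" "w \<in> lat D"
  proof -
    obtain q where q: "\<forall>v\<in>lat D. q v \<in> B"
      "\<forall>v\<in>lat D. \<forall>w\<in>lat D. h v w + h v w = q (v + w) - q v - q w"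
      using form \<open>quad D\<close> by (auto simp: associated_def)
    then have "h v w + h v w = q (v + w) - q v - q w"
      using that by blast
    also have "\<dots> \<in> B"
      using q(1) that by (intro diff_mem_B) (auto intro: lat_add)
    finally show ?thesis .
  qed
qed

text \<open>In the quadratic case K is the image of F, so K \<otimes> R is commutative with trivial
  involution.\<close>

lemma ext_psi_mem_H0:
  assumes "X \<in> T0 (dat E)"
  shows "psi (dat E) X \<in> H0 (dat E)"
proof (rule ext.psi_mem_H0[OF assms tensor_facts(7)])
  note L = tensor_facts(9,10)
  have lat_form: "form (dat E) v w \<in> maxord (dat E)"
    if nq: "\<not> quad D" and v: "v \<in> lat (dat E)" and w: "w \<in> lat (dat E)" for v w
    using v unfolding L
  proof (induction v rule: V.extend_set_induct)
    case (tau v r)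
    show ?case
      using w unfolding L
    proof (induction w rule: V.extend_set_induct)
      case (tau w s)
      then show ?case
        using \<open>v \<in> _\<close> \<open>r \<in> _\<close> nq by (simp add: form_tensor K.mem_extend_set lat_form_nonquad)
    qed (simp_all add: form_add_right form_zero_right K.add_mem_extend_set K.zero_mem_extend_set)
  qed (simp_all add: form_add_left form_zero_left K.add_mem_extend_set K.zero_mem_extend_set)
  show "\<forall>v\<in>lat (dat E). \<forall>w\<in>lat (dat E). form (dat E) v w \<in> maxord (dat E)"
    if "\<not> quad (dat E)"
    using that lat_form by (simp add: tensor_facts(16))
  have double: "form (dat E) v w + form (dat E) v w \<in> maxord (dat E)"
    if q: "quad D" and v: "v \<in> lat (dat E)" and w: "w \<in> lat (dat E)" for v w
    using v unfolding L
  proof (induction v rule: V.extend_set_induct)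
    case (tau v r)
    show ?case
      using w unfolding L
    proof (induction w rule: V.extend_set_induct)
      case (tau w s)
      \<comment> \<open>Integrality over A is known for the sum of the two equal values, so the two
        elementary tensors are merged before it is applied.\<close>
      then show ?case
        using \<open>v \<in> _\<close> \<open>r \<in> _\<close> q
        by (simp add: form_tensor K.tau_add_left[symmetric] K.mem_extend_set quad_double)
    next
      case (add u w)
      from K.add_mem_extend_set[OF add] show ?case
        by (simp add: form_add_right algebra_simps)
    qed (simp add: form_zero_right K.zero_mem_extend_set)
  next
    case (add u v)
    from K.add_mem_extend_set[OF add] show ?case
      by (simp add: form_add_left algebra_simps)
  qed (simp add: form_zero_left K.zero_mem_extend_set)
  show "eps (dat E) = 1 \<and> (\<forall>x. invol (dat E) x = x) \<and> (\<forall>x y :: 'kr. x * y = y * x) \<and>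
      (\<forall>v\<in>lat (dat E). \<forall>w\<in>lat (dat E). form (dat E) v w + form (dat E) v w \<in> maxord (dat E))"
    if "quad (dat E)"
  proof (intro conjI allI ballI)
    have q: "quad D"
      using that by (simp add: tensor_facts(16))
    note qf = quad_facts[OF q]
    show "eps (dat E) = 1"
      using qf by (simp add: tensor_facts(15))
    show "invol (dat E) x = x" for x
      by (induction x rule: K.tensor_induct) (simp_all add: invol_tensor qf invol_add)
    have comm: "k * l = l * k" for k l :: 'k
    proof -
      obtain a where "k = \<iota> a"
        using qf by (metis surjD)
      then show ?thesis
        by (simp only: iota_central)
    qed
    show "x * y = y * x" for x y :: 'kr
    proof (induction x rule: K.tensor_induct)
      case (tau k r)
      show ?case
      proof (induction y rule: K.tensor_induct)
        case (tau l s)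
        show ?case
          using \<open>r \<in> _\<close> \<open>s \<in> _\<close> by (simp add: tK_mult comm[of k l] K.R.m_comm[of r s])
      qed (simp add: distrib_left distrib_right)
    qed (simp add: distrib_left distrib_right)
  qed (use that double in \<open>simp add: tensor_facts(16)\<close>)
qed

section \<open>Endomorphisms of V \<otimes> R given by elementary tensors\<close>

lemma end_tensor:
  assumes X: "X \<in> endos D" and r: "r \<in> carrier R"
  shows "additive (end_tensor R E r X)"
    and "s \<in> carrier R \<Longrightarrow> end_tensor R E r X (tV E v s) = tV E (X v) (s \<otimes>\<^bsub>R\<^esub> r)"
proof -
  have "\<exists>!Z. additive Z \<and> (\<forall>v. \<forall>s\<in>carrier R. Z (tV E v s) = tV E (X v) (s \<otimes>\<^bsub>R\<^esub> r))"
  proof (rule V.lift_exists)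
    show "tV E (X (v + w)) (s \<otimes>\<^bsub>R\<^esub> r) = tV E (X v) (s \<otimes>\<^bsub>R\<^esub> r) + tV E (X w) (s \<otimes>\<^bsub>R\<^esub> r)"
      if "s \<in> carrier R" for v w s
      using that r by (simp add: additive.add[OF endos_additive[OF X]] V.tau_add_left)
    show "tV E (X v) ((s \<oplus>\<^bsub>R\<^esub> t) \<otimes>\<^bsub>R\<^esub> r) =
        tV E (X v) (s \<otimes>\<^bsub>R\<^esub> r) + tV E (X v) (t \<otimes>\<^bsub>R\<^esub> r)"
      if "s \<in> carrier R" "t \<in> carrier R" for v s t
      using that r by (simp add: K.R.l_distr V.tau_add_right)
    show "tV E (X (v \<cdot> \<iota> a)) (s \<otimes>\<^bsub>R\<^esub> r) = tV E (X v) ((a \<odot>\<^bsub>R\<^esub> s) \<otimes>\<^bsub>R\<^esub> r)"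
      if "a \<in> carrier (int_ring val)" "s \<in> carrier R" for a v s
      using that r by (simp add: endos_act[OF X] V.tau_balanced V.smult_mult_assoc)
  qed
  from theI'[OF this, folded end_tensor_def]
  show "additive (end_tensor R E r X)"
    and "s \<in> carrier R \<Longrightarrow> end_tensor R E r X (tV E v s) = tV E (X v) (s \<otimes>\<^bsub>R\<^esub> r)"
    by blast+
qed

lemmas end_tensor_add = end_tensor(1)[THEN additive.add]

lemma end_tensor_T0:
  assumes X: "X \<in> T0 D" and r: "r \<in> carrier R"
  shows "end_tensor R E r X \<in> T0 (dat E)"
proof -
  note et = end_tensor[OF T0_endos[OF X] r]
  have extend: "end_tensor R E r X u \<in> extend_set R (tV E) S"
    if "u \<in> extend_set R (tV E) S" "\<And>v. v \<in> S \<Longrightarrow> X v \<in> S" for S u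
    using that(1)
    by (induction u rule: V.extend_set_induct)
      (simp_all add: et(2) r additive.add[OF et(1)] additive.zero[OF et(1)] that(2)
        V.zero_mem_extend_set V.mem_extend_set V.add_mem_extend_set)
  have act: "end_tensor R E r X (act (dat E) u k) = act (dat E) (end_tensor R E r X u) k" for u k
  proof (induction u rule: V.tensor_induct)
    case (tau v s)
    show ?case
    proof (induction k rule: K.tensor_induct)
      case (tau k t)
      have "(s \<otimes>\<^bsub>R\<^esub> t) \<otimes>\<^bsub>R\<^esub> r = (s \<otimes>\<^bsub>R\<^esub> r) \<otimes>\<^bsub>R\<^esub> t"
        using \<open>s \<in> _\<close> \<open>t \<in> _\<close> r by (simp add: K.R.m_ac)
      then show ?case
        using \<open>s \<in> _\<close> \<open>t \<in> _\<close> r by (simp add: act_tensor et(2) endos_act[OF T0_endos[OF X]])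
    qed (simp add: ext.act_add_right additive.add[OF et(1)])
  qed (simp add: ext.act_add_left additive.add[OF et(1)])
  show ?thesis
  proof (rule ext.T0I)
    show "end_tensor R E r X \<in> endos (dat E)"
      by (rule ext.endosI[OF et(1) act])
  qed (use extend T0_lat[OF X] T0_dlat[OF X] in \<open>simp_all add: tensor_facts(10,11)\<close>)
qed

lemma end_tensor_comp:
  assumes X: "X \<in> endos D" and Y: "Y \<in> endos D" and rs: "r \<in> carrier R" "s \<in> carrier R"
  shows "end_tensor R E r X (end_tensor R E s Y u) =
    end_tensor R E (r \<otimes>\<^bsub>R\<^esub> s) (\<lambda>v. X (Y v)) u"
proof (induction u rule: V.tensor_induct)
  case (tau v t)
  have "(t \<otimes>\<^bsub>R\<^esub> s) \<otimes>\<^bsub>R\<^esub> r = t \<otimes>\<^bsub>R\<^esub> (r \<otimes>\<^bsub>R\<^esub> s)"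
    using tau rs by (simp add: K.R.m_ac)
  then show ?case
    using tau rs by (simp add: end_tensor(2) X Y endos_comp[OF X Y])
qed (simp add: end_tensor_add X Y endos_comp[OF X Y] rs)

lemma end_tensor_adj:
  assumes X: "X \<in> T0 D" and r: "r \<in> carrier R"
  shows "adj (dat E) (end_tensor R E r X) = end_tensor R E r (adj D X)"
proof (rule ext.adj_eqI[OF ext.T0_endos[OF end_tensor_T0[OF X r]]])
  note Xe = T0_endos[OF X]
  note et = end_tensor[OF Xe r] and et' = end_tensor[OF adj(1)[OF Xe] r]
  show "form (dat E) (end_tensor R E r X u) w = form (dat E) u (end_tensor R E r (adj D X) w)"
    for u w
  proof (induction u rule: V.tensor_induct)
    case (tau v s)
    show ?case
    proof (induction w rule: V.tensor_induct)
      case (tau w t)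
      have "(s \<otimes>\<^bsub>R\<^esub> r) \<otimes>\<^bsub>R\<^esub> t = s \<otimes>\<^bsub>R\<^esub> (t \<otimes>\<^bsub>R\<^esub> r)"
        using \<open>s \<in> _\<close> \<open>t \<in> _\<close> r by (simp add: K.R.m_ac)
      then show ?case
        using \<open>s \<in> _\<close> \<open>t \<in> _\<close> r by (simp add: et(2) et'(2) form_tensor adj(2)[OF Xe])
    qed (simp add: form_add_right additive.add[OF et'(1)])
  qed (simp add: form_add_left additive.add[OF et(1)])
qed

text \<open>The square of \<open>r\<close> reflects that \<open>phi\<close> is quadratic, as for
  scalars from A.\<close>

lemma end_tensor_phi:
  assumes X: "X \<in> endos D" and Y: "Y \<in> endos D" and r: "r \<in> carrier R"
    and phi: "phi D X = psi D Y"
  shows "phi (dat E) (end_tensor R E r X) = psi (dat E) (end_tensor R E (r \<otimes>\<^bsub>R\<^esub> r) Y)"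
proof (intro HOL.ext)
  fix u w
  have rr: "r \<otimes>\<^bsub>R\<^esub> r \<in> carrier R"
    using r by simp
  note et = end_tensor[OF X r] and et' = end_tensor[OF Y rr]
  have *: "h (X v) (X w) = h v (Y w) + h (Y v) w" for v w
    using fun_cong[OF fun_cong[OF phi]] by (simp add: phi_def psi_def)
  show "phi (dat E) (end_tensor R E r X) u w = psi (dat E) (end_tensor R E (r \<otimes>\<^bsub>R\<^esub> r) Y) u w"
    unfolding phi_def psi_def
  proof (induction u rule: V.tensor_induct)
    case (tau v s)
    show ?case
    proof (induction w rule: V.tensor_induct)
      case (tau w t)
      have "(s \<otimes>\<^bsub>R\<^esub> r) \<otimes>\<^bsub>R\<^esub> (t \<otimes>\<^bsub>R\<^esub> r) = s \<otimes>\<^bsub>R\<^esub> (t \<otimes>\<^bsub>R\<^esub> (r \<otimes>\<^bsub>R\<^esub> r))"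
        "(s \<otimes>\<^bsub>R\<^esub> (r \<otimes>\<^bsub>R\<^esub> r)) \<otimes>\<^bsub>R\<^esub> t = s \<otimes>\<^bsub>R\<^esub> (t \<otimes>\<^bsub>R\<^esub> (r \<otimes>\<^bsub>R\<^esub> r))"
        using \<open>s \<in> _\<close> \<open>t \<in> _\<close> r by (simp_all add: K.R.m_ac)
      then show ?case
        using \<open>s \<in> _\<close> \<open>t \<in> _\<close> r by (simp add: et(2) et'(2) form_tensor * K.tau_add_left)
    qed (simp add: form_add_right additive.add[OF et(1)] additive.add[OF et'(1)] algebra_simps)
  qed (simp add: form_add_left additive.add[OF et(1)] additive.add[OF et'(1)] algebra_simps)
qed

text \<open>For \<open>M = T D m\<close> this is \<open>T_ext D R E m\<close> when m > 0. At level 0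
  only its inclusion in \<open>T_ext D R E 0\<close> is established.\<close>

definition ext_span :: "('v \<Rightarrow> 'v) set \<Rightarrow> ('vr \<Rightarrow> 'vr) set" where
  "ext_span M = {(\<lambda>u. \<Sum>(r, X)\<in>#s. end_tensor R E r X u) | s. set_mset s \<subseteq> carrier R \<times> M}"

lemma zero_mem_ext_span: "(\<lambda>u. 0) \<in> ext_span M"
  unfolding ext_span_def by (intro CollectI exI[of _ "{#}"]) simp

lemma end_tensor_mem_ext_span: "r \<in> carrier R \<Longrightarrow> X \<in> M \<Longrightarrow> end_tensor R E r X \<in> ext_span M"
  unfolding ext_span_def by (intro CollectI exI[of _ "{#(r, X)#}"]) simp

lemma add_mem_ext_span:
  assumes "Y \<in> ext_span M" "Z \<in> ext_span M"
  shows "(\<lambda>u. Y u + Z u) \<in> ext_span M"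
proof -
  obtain s t where "set_mset s \<subseteq> carrier R \<times> M" "Y = (\<lambda>u. \<Sum>(r, X)\<in>#s. end_tensor R E r X u)"
    "set_mset t \<subseteq> carrier R \<times> M" "Z = (\<lambda>u. \<Sum>(r, X)\<in>#t. end_tensor R E r X u)"
    using assms by (auto simp: ext_span_def)
  then show ?thesis
    unfolding ext_span_def by (intro CollectI exI[of _ "s + t"]) simp
qed

lemma ext_span_induct [consumes 1, case_names zero add]:
  assumes "Y \<in> ext_span M" and zero: "P (\<lambda>u. 0)"
    and add: "\<And>r X Z. r \<in> carrier R \<Longrightarrow> X \<in> M \<Longrightarrow> Z \<in> ext_span M \<Longrightarrow> P Z \<Longrightarrow>
      P (\<lambda>u. end_tensor R E r X u + Z u)"
  shows "P Y"
proof -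
  obtain s where s: "set_mset s \<subseteq> carrier R \<times> M" "Y = (\<lambda>u. \<Sum>(r, X)\<in>#s. end_tensor R E r X u)"
    using assms(1) by (auto simp: ext_span_def)
  have "P (\<lambda>u. \<Sum>(r, X)\<in>#s. end_tensor R E r X u)"
    using s(1)
  proof (induction s)
    case empty
    show ?case
      by (simp add: zero)
  next
    case (add rX s)
    obtain r X where rX: "rX = (r, X)"
      by (cases rX)
    have "(\<lambda>u. \<Sum>(r, X)\<in>#s. end_tensor R E r X u) \<in> ext_span M"
        using add.prems by (auto simp: ext_span_def)
    then show ?case
      using assms(3)[of r X "\<lambda>u. \<Sum>(r, X)\<in>#s. end_tensor R E r X u"] add by (simp add: rX)
  qed
  then show ?thesis
    by (simp add: s(2))
qed

lemma ext_span_T0: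
  assumes "M \<subseteq> T0 D"
  shows "ext_span M \<subseteq> T0 (dat E)"
proof
  fix Y assume "Y \<in> ext_span M"
  then show "Y \<in> T0 (dat E)"
  proof (induction Y rule: ext_span_induct)
    case (add r X Z)
    then show ?case
      using assms by (intro ext.T0_add[OF end_tensor_T0]) auto
  qed (rule ext.T0_zero)
qed

lemma T_subset_T0: "T D m \<subseteq> T0 D"
  using T_antimono[of 0 m] by simp

text \<open>An elementary left factor is enough: in the induction on sums it is the newly added
  summand whose adjoint is composed with the rest.\<close>

lemma ext_span_comp:
  assumes X: "X \<in> T D m" and r: "r \<in> carrier R" and Y: "Y \<in> ext_span (T D m)"
  shows "(\<lambda>u. end_tensor R E r X (Y u)) \<in> ext_span (T D m)"
  using Y
proof (induction Y rule: ext_span_induct)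
  case zero
  then show ?case
    using additive.zero[OF end_tensor(1)[OF T_endos[OF X] r]] zero_mem_ext_span by simp
next
  case (add s Y Z)
  have "end_tensor R E (r \<otimes>\<^bsub>R\<^esub> s) (\<lambda>v. X (Y v)) \<in> ext_span (T D m)"
    by (rule end_tensor_mem_ext_span[OF K.R.m_closed[OF r add(1)] T_comp[OF X add(2)]])
  from add_mem_ext_span[OF this add(4)] show ?case
    using add r by (simp add: end_tensor_add end_tensor_comp T_endos[OF X] T_endos[of Y m])
qed

text \<open>Induction on the number of elementary summands. The cross term stays in the span because
  the adjoint of r \<otimes> X is r \<otimes> X^ad and the stages over A are closed under
  products.\<close>

lemma phi_ext_span:
  assumes stable: "\<And>X. X \<in> T D m \<Longrightarrow> phi D X \<in> psi D ` T D m"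
    and Y: "Y \<in> ext_span (T D m)"
  shows "phi (dat E) Y \<in> psi (dat E) ` ext_span (T D m)"
  using Y
proof (induction Y rule: ext_span_induct)
  case zero
  have "phi (dat E) (\<lambda>u. 0) = psi (dat E) (\<lambda>u. 0)"
    by (simp add: phi_def psi_def form_zero_left form_zero_right fun_eq_iff)
  then show ?case
    using zero_mem_ext_span by blast
next
  case (add r X Z)
  have X: "X \<in> T0 D" "X \<in> endos D"
    using add T_subset_T0 T_endos by auto
  obtain W where W: "W \<in> T D m" "phi D X = psi D W"
    using stable[OF add(2)] by blast
  obtain Z' where Z': "Z' \<in> ext_span (T D m)" "phi (dat E) Z = psi (dat E) Z'"
    using add by blast
  have rr: "r \<otimes>\<^bsub>R\<^esub> r \<in> carrier R"
    using add by simp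
  have endos: "Y \<in> endos (dat E)" if "Y \<in> ext_span (T D m)" for Y
    using that ext_span_T0[OF T_subset_T0] ext.T0_endos by blast
  have "phi (dat E) (\<lambda>u. end_tensor R E r X u + Z u) = psi (dat E)
      (\<lambda>u. end_tensor R E (r \<otimes>\<^bsub>R\<^esub> r) W u + Z' u + adj (dat E) (end_tensor R E r X) (Z u))"
    using add(1-3) W Z' rr
    by (intro ext.phi_add endos end_tensor_mem_ext_span end_tensor_phi[OF X(2) T_endos[OF W(1)]])
      assumption+
  moreover have "(\<lambda>u. end_tensor R E (r \<otimes>\<^bsub>R\<^esub> r) W u + Z' u + adj (dat E) (end_tensor R E r X) (Z u))
      \<in> ext_span (T D m)"
    unfolding end_tensor_adj[OF X(1) add(1)]
    by (rule add_mem_ext_span[OF add_mem_ext_span[OF end_tensor_mem_ext_span[OF rr W(1)] Z'(1)]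
        ext_span_comp[OF T_adj[OF add(2)] add(1,3)]])
  ultimately show ?case
    by blast
qed

section \<open>The inclusions over R\<close>

lemma T_tilde_cases:
  obtains "alpha D = 0" "T_tilde D R E = T0 (dat E)"
  | "T_tilde D R E = ext_span (T D (alpha D))"
  by (cases "alpha D") (simp_all add: T_tilde_def ext_span_def)

lemma T_tilde_subset_T0: "T_tilde D R E \<subseteq> T0 (dat E)"
  using ext_span_T0[OF T_subset_T0] by (cases rule: T_tilde_cases) auto

text \<open>If \<open>\<alpha> = 0\<close>, then the identity lies in \<open>T\<^sup>1(A)\<close>, so \<open>h = \<psi> Z\<close> with \<open>Z \<in> T\<^sup>0(A)\<close> and
  \<open>\<phi> X = \<psi> (X\<^sup>a\<^sup>d Z X)\<close> for all \<open>X\<close>.\<close>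

lemma phi_T_tilde: "phi (dat E) ` T_tilde D R E \<subseteq> H_tilde D R E"
proof (cases rule: T_tilde_cases)
  case 1
  have id: "(\<lambda>v. v) \<in> T D (alpha D)"
    using 1(1) by (simp add: T0_def endos_def additive_def)
  from phi_T_alpha[OF this] obtain Z where Z: "Z \<in> T0 D" "phi D (\<lambda>v. v) = psi D Z"
    using 1(1) by auto
  have id0: "(\<lambda>v. v) \<in> endos D"
    using T_endos[OF id] .
  \<comment> \<open>The identity over R is 1 \<otimes> id, so the relation h = psi(Z) over A is
    carried to R by the rule for elementary tensors.\<close>
  have et_id: "end_tensor R E \<one>\<^bsub>R\<^esub> (\<lambda>v. v) = (\<lambda>u. u)"
    by (rule V.additive_eqI)
      (simp_all add: end_tensor[OF id0 K.R.one_closed], simp add: additive_def)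
  have phi_id: "phi (dat E) (\<lambda>u. u) = psi (dat E) (end_tensor R E \<one>\<^bsub>R\<^esub> Z)"
    using end_tensor_phi[OF id0 T0_endos[OF Z(1)] K.R.one_closed Z(2)] by (simp add: et_id)
  have Z0: "end_tensor R E \<one>\<^bsub>R\<^esub> Z \<in> T0 (dat E)"
    by (rule end_tensor_T0[OF Z(1) K.R.one_closed])
  have id_ext: "(\<lambda>u. u) \<in> endos (dat E)"
    by (simp add: endos_def additive_def)
  have "phi (dat E) X \<in> psi (dat E) ` T0 (dat E)" if X: "X \<in> T0 (dat E)" for X
  proof -
    have "phi (dat E) X = psi (dat E) (\<lambda>u. adj (dat E) X (end_tensor R E \<one>\<^bsub>R\<^esub> Z (X u)))"
      using ext.phi_comp[OF id_ext ext.T0_endos[OF X] phi_id ext.T0_endos[OF Z0]] by simp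
    moreover have "(\<lambda>u. adj (dat E) X (end_tensor R E \<one>\<^bsub>R\<^esub> Z (X u))) \<in> T0 (dat E)"
      by (rule ext.T0_comp[OF ext.T0_adj[OF X] ext.T0_comp[OF Z0 X]])
    ultimately show ?thesis
      by blast
  qed
  then show ?thesis
    using 1 by (auto simp: H_tilde_def)
next
  case 2
  then show ?thesis
    using phi_ext_span[OF phi_T_alpha] by (auto simp: H_tilde_def)
qed

lemma H_tilde_subset_H0: "H_tilde D R E \<subseteq> H0 (dat E)"
  using T_tilde_subset_T0 ext_psi_mem_H0 by (auto simp: H_tilde_def)

end

section \<open>Functoriality\<close>

locale base_change =
  src: scalar_ext val D \<iota> n e b c R E + tgt: scalar_ext val D \<iota> n e b c S E'
  for val :: "'f::field \<Rightarrow> int" and D :: "('k::ring_1, 'v::ab_group_add) herm"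
    and \<iota> n e b c and R :: "('f, 'r) module"
    and E :: "('k, 'v, 'r, 'kr::{ring,monoid_mult}, 'vr::ab_group_add) extension"
    and S :: "('f, 's) module"
    and E' :: "('k, 'v, 's, 'ks::{ring,monoid_mult}, 'vs::ab_group_add) extension" +
  fixes g :: "'r \<Rightarrow> 's"
  assumes algebra_hom: "algebra_hom val R S g"
begin

abbreviation GV :: "'vr \<Rightarrow> 'vs" where "GV \<equiv> tensor_map R (tV E) (tV E') g"

abbreviation GK :: "'kr \<Rightarrow> 'ks" where "GK \<equiv> tensor_map R (tK E) (tK E') g"

lemma g_closed: "r \<in> carrier R \<Longrightarrow> g r \<in> carrier S"
  and g_add: "r \<in> carrier R \<Longrightarrow> s \<in> carrier R \<Longrightarrow> g (r \<oplus>\<^bsub>R\<^esub> s) = g r \<oplus>\<^bsub>S\<^esub> g s"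
  and g_mult: "r \<in> carrier R \<Longrightarrow> s \<in> carrier R \<Longrightarrow> g (r \<otimes>\<^bsub>R\<^esub> s) = g r \<otimes>\<^bsub>S\<^esub> g s"
  and g_one: "g \<one>\<^bsub>R\<^esub> = \<one>\<^bsub>S\<^esub>"
  and g_smult: "a \<in> carrier (int_ring val) \<Longrightarrow> r \<in> carrier R \<Longrightarrow> g (a \<odot>\<^bsub>R\<^esub> r) = a \<odot>\<^bsub>S\<^esub> g r"
  using algebra_hom
  by (auto simp: algebra_hom_def ring_hom_closed ring_hom_add ring_hom_mult ring_hom_one)

lemma GV: "additive GV" "r \<in> carrier R \<Longrightarrow> GV (tV E v r) = tV E' v (g r)"
proof -
  have "\<exists>!G. additive G \<and> (\<forall>v. \<forall>r\<in>carrier R. G (tV E v r) = tV E' v (g r))"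
    by (rule src.V.lift_exists) (simp_all add: g_closed g_add g_smult tgt.V.tau_add_left
        tgt.V.tau_add_right tgt.V.tau_balanced)
  from theI'[OF this, folded tensor_map_def]
  show "additive GV" "r \<in> carrier R \<Longrightarrow> GV (tV E v r) = tV E' v (g r)"
    by blast+
qed

lemma GK: "additive GK" "r \<in> carrier R \<Longrightarrow> GK (tK E x r) = tK E' x (g r)"
proof -
  have "\<exists>!G. additive G \<and> (\<forall>x. \<forall>r\<in>carrier R. G (tK E x r) = tK E' x (g r))"
    by (rule src.K.lift_exists) (simp_all add: g_closed g_add g_smult tgt.K.tau_add_left
        tgt.K.tau_add_right tgt.K.tau_balanced)
  from theI'[OF this, folded tensor_map_def]
  show "additive GK" "r \<in> carrier R \<Longrightarrow> GK (tK E x r) = tK E' x (g r)"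
    by blast+
qed

lemmas GV_add = additive.add[OF GV(1)]
lemmas GK_add = additive.add[OF GK(1)]

lemma GV_act: "GV (act (dat E) u k) = act (dat E') (GV u) (GK k)"
proof (induction u rule: src.V.tensor_induct)
  case (tau v r)
  show ?case
  proof (induction k rule: src.K.tensor_induct)
    case (tau k s)
    then show ?case
      using \<open>r \<in> _\<close> by (simp add: src.act_tensor tgt.act_tensor GV GK g_closed g_mult)
  qed (simp add: src.act_ext_add tgt.act_ext_add GV_add GK_add)
qed (simp add: src.act_ext_add tgt.act_ext_add GV_add)

lemma GK_form: "GK (form (dat E) u w) = form (dat E') (GV u) (GV w)"
proof (induction u rule: src.V.tensor_induct)
  case (tau v r)
  show ?case
  proof (induction w rule: src.V.tensor_induct)
    case (tau w s)
    then show ?case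
      using \<open>r \<in> _\<close> by (simp add: src.form_tensor tgt.form_tensor GV GK g_closed g_mult)
  qed (simp add: src.form_add_right tgt.form_add_right GV_add GK_add)
qed (simp add: src.form_add_left tgt.form_add_left GV_add GK_add)

text \<open>The tensors v \<otimes> 1 come from R and generate V \<otimes> S over K \<otimes> S.
  Hence an endomorphism or a sesquilinear form over S is determined by its values on the image of
  \<open>GV\<close>.\<close>

lemma tensor_eq_act: "s \<in> carrier S \<Longrightarrow>
    tV E' v s = act (dat E') (GV (tV E v \<one>\<^bsub>R\<^esub>)) (tK E' 1 s)"
  by (simp add: GV g_one tgt.act_tensor src.act_one)

lemma change_end_eqI:
  assumes Y: "Y \<in> endos (dat E')" "\<And>u. Y (GV u) = GV (X u)"
  shows "change_end R E E' g X = Y"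
  unfolding change_end_def
proof (rule the_equality)
  fix Y' assume Y': "Y' \<in> endos (dat E') \<and> (\<forall>u. Y' (GV u) = GV (X u))"
  show "Y' = Y"
  proof (rule tgt.V.additive_eqI)
    fix v s assume "s \<in> carrier S"
    then show "Y' (tV E' v s) = Y (tV E' v s)"
      using Y Y' tgt.ext.endos_act[of Y] tgt.ext.endos_act[of Y']
      by (simp only: tensor_eq_act)
  qed (use Y Y' tgt.ext.endos_additive in auto)
qed (use Y in simp)

text \<open>The new endomorphism is assembled from the transported images of the basis vectors, with
  coordinates read off by pairing with the transported \<open>c i\<close>. It continues X because
  \<open>GV\<close> and \<open>GK\<close> respect action and form.\<close>

lemma change_end:
  assumes X: "X \<in> endos (dat E)"
  shows "change_end R E E' g X \<in> endos (dat E')" "change_end R E E' g X (GV u) = GV (X u)"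
proof -
  let ?e = "\<lambda>i. tV E (e i) \<one>\<^bsub>R\<^esub>" and ?c = "\<lambda>i. tV E (c i) \<one>\<^bsub>R\<^esub>"
  define Y where "Y w = (\<Sum>i<n. act (dat E') (GV (X (?e i))) (form (dat E') (GV (?c i)) w))" for w
  have Ye: "Y \<in> endos (dat E')"
    by (rule tgt.ext.endosI)
      (simp_all add: Y_def additive_def tgt.ext.h_add_right tgt.ext.act_add_right sum.distrib
        tgt.ext.h_act_right tgt.ext.act_mult tgt.ext.act_sum_left)
  have YG: "Y (GV u) = GV (X u)" for u
  proof -
    have "Y (GV u) = GV (X (\<Sum>i<n. act (dat E) (?e i) (form (dat E) (?c i) u)))"
      unfolding additive.sum[OF src.ext.endos_additive[OF X]] additive.sum[OF GV(1)]
        src.ext.endos_act[OF X] GV_act GK_form Y_def ..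
    then show ?thesis
      by (simp only: src.ext.expand_e)
  qed
  show "change_end R E E' g X \<in> endos (dat E')" "change_end R E E' g X (GV u) = GV (X u)"
    unfolding change_end_eqI[OF Ye YG] by (rule Ye, rule YG)
qed

lemma GV_extend_set:
  assumes "u \<in> extend_set R (tV E) M"
  shows "GV u \<in> extend_set S (tV E') M"
  using assms
  by (induction u rule: src.V.extend_set_induct)
    (simp_all add: additive.zero[OF GV(1)] GV g_closed GV_add tgt.V.zero_mem_extend_set
      tgt.V.mem_extend_set tgt.V.add_mem_extend_set)

text \<open>This serves alpha = 0, where elements over R are not given as sums. A vector l \<otimes>
  s is l \<otimes> 1 times a scalar of B \<otimes> S, because 1 lies in B.\<close>

lemma change_end_T0:
  assumes X: "X \<in> T0 (dat E)"
  shows "change_end R E E' g X \<in> T0 (dat E')"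
proof -
  let ?Y = "change_end R E E' g X"
  note Y = change_end[OF src.ext.T0_endos[OF X]]
  have one: "tK E' 1 s \<in> maxord (dat E')" if "s \<in> carrier S" for s
    using that src.one_mem_B by (simp add: tgt.tensor_facts(9) tgt.K.mem_extend_set)
  show ?thesis
  proof (rule tgt.ext.T0I[OF Y(1)])
    fix w assume "w \<in> lat (dat E')"
    then show "?Y w \<in> lat (dat E')"
      unfolding tgt.tensor_facts(10)
    proof (induction w rule: tgt.V.extend_set_induct)
      case (tau l s)
      have "X (tV E l \<one>\<^bsub>R\<^esub>) \<in> lat (dat E)"
        using tau by (intro src.ext.T0_lat[OF X])
          (simp add: src.tensor_facts(10) src.V.mem_extend_set)
      then have "GV (X (tV E l \<one>\<^bsub>R\<^esub>)) \<in> lat (dat E')"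
        unfolding src.tensor_facts(10) tgt.tensor_facts(10) by (rule GV_extend_set)
      then have "act (dat E') (GV (X (tV E l \<one>\<^bsub>R\<^esub>))) (tK E' 1 s) \<in> lat (dat E')"
        using one[OF tau(2)] by (rule tgt.ext.lat_act)
      then show ?case
        by (simp add: tensor_eq_act[OF tau(2)] tgt.ext.endos_act[OF Y(1)] Y(2) tgt.tensor_facts(10))
    qed (simp_all add: additive.zero[OF tgt.ext.endos_additive[OF Y(1)]]
        additive.add[OF tgt.ext.endos_additive[OF Y(1)]] tgt.V.zero_mem_extend_set
        tgt.V.add_mem_extend_set)
  next
    fix w assume "w \<in> dlat (dat E')"
    then show "?Y w \<in> dlat (dat E')"
      unfolding tgt.tensor_facts(11)
    proof (induction w rule: tgt.V.extend_set_induct)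
      case (tau l s)
      have "X (tV E l \<one>\<^bsub>R\<^esub>) \<in> dlat (dat E)"
        using tau by (intro src.ext.T0_dlat[OF X])
          (simp add: src.tensor_facts(11) src.V.mem_extend_set)
      then have "GV (X (tV E l \<one>\<^bsub>R\<^esub>)) \<in> dlat (dat E')"
        unfolding src.tensor_facts(11) tgt.tensor_facts(11) by (rule GV_extend_set)
      then have "act (dat E') (GV (X (tV E l \<one>\<^bsub>R\<^esub>))) (tK E' 1 s) \<in> dlat (dat E')"
        using one[OF tau(2)] by (rule tgt.ext.dlat_act)
      then show ?case
        by (simp add: tensor_eq_act[OF tau(2)] tgt.ext.endos_act[OF Y(1)] Y(2) tgt.tensor_facts(11))
    qed (simp_all add: additive.zero[OF tgt.ext.endos_additive[OF Y(1)]]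
        additive.add[OF tgt.ext.endos_additive[OF Y(1)]] tgt.V.zero_mem_extend_set
        tgt.V.add_mem_extend_set)
  qed
qed

text \<open>Base change sends r \<otimes> X to g(r) \<otimes> X with the same X, so the stage is
  kept.\<close>

lemma change_end_ext_span:
  assumes "X \<in> src.ext_span (T D m)"
  shows "change_end R E E' g X \<in> tgt.ext_span (T D m)"
  using assms
proof (induction X rule: src.ext_span_induct)
  case zero
  have "change_end R E E' g (\<lambda>u. 0) = (\<lambda>u. 0)"
    by (rule change_end_eqI[OF tgt.ext.endos_zero]) (simp add: additive.zero[OF GV(1)])
  then show ?case
    by (simp add: tgt.zero_mem_ext_span)
next
  case (add r X Z)
  have X: "X \<in> T0 D" "X \<in> endos D"
    using add src.T_subset_T0 src.T_endos by auto
  have Z: "Z \<in> endos (dat E)"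
    using add src.ext_span_T0[OF src.T_subset_T0] src.ext.T0_endos by blast
  have et: "end_tensor S E' (g r) X (GV u) = GV (end_tensor R E r X u)" for u
    by (induction u rule: src.V.tensor_induct)
      (simp_all add: GV GV_add g_closed g_mult add(1) src.end_tensor(2)[OF X(2) add(1)]
        tgt.end_tensor(2)[OF X(2) g_closed[OF add(1)]]
        src.end_tensor_add[OF X(2) add(1)] tgt.end_tensor_add[OF X(2) g_closed[OF add(1)]])
  have "change_end R E E' g (\<lambda>u. end_tensor R E r X u + Z u) =
      (\<lambda>u. end_tensor S E' (g r) X u + change_end R E E' g Z u)"
  proof (rule change_end_eqI)
    show "(\<lambda>u. end_tensor S E' (g r) X u + change_end R E E' g Z u) \<in> endos (dat E')"
      by (rule tgt.ext.endos_add[OF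
          tgt.ext.T0_endos[OF tgt.end_tensor_T0[OF X(1) g_closed[OF add(1)]]] change_end(1)[OF Z]])
  qed (simp add: et change_end(2)[OF Z] GV_add)
  then show ?case
    using tgt.add_mem_ext_span[OF tgt.end_tensor_mem_ext_span[OF g_closed[OF add(1)] add(2)] add(4)]
    by simp
qed

lemma change_end_T_tilde:
  assumes "X \<in> T_tilde D R E"
  shows "change_end R E E' g X \<in> T_tilde D S E'"
proof (cases "alpha D")
  case 0
  then show ?thesis
    using assms change_end_T0 by (simp add: T_tilde_def)
next
  case (Suc m)
  then have "T_tilde D R E = src.ext_span (T D (alpha D))"
    "T_tilde D S E' = tgt.ext_span (T D (alpha D))"
    by (simp_all add: T_tilde_def src.ext_span_def tgt.ext_span_def)
  then show ?thesis
    using assms change_end_ext_span by simp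
qed

section \<open>Base change of forms\<close>

lemma change_form_eqI:
  assumes f': "sesquilinear (dat E') f'" "\<And>u w. f' (GV u) (GV w) = GK (f u w)"
  shows "change_form R E E' g f = f'"
  unfolding change_form_def
proof (rule the_equality)
  fix f'' assume f'': "sesquilinear (dat E') f'' \<and> (\<forall>u w. f'' (GV u) (GV w) = GK (f u w))"
  note sesq = f'(1)[unfolded sesquilinear_def] f''[THEN conjunct1, unfolded sesquilinear_def]
  show "f'' = f'"
  proof (intro HOL.ext)
    fix u w
    show "f'' u w = f' u w"
    proof (induction u rule: tgt.V.tensor_induct)
      case (tau v r)
      show ?case
      proof (induction w rule: tgt.V.tensor_induct)
        case (tau w s)
        have act: "f (act (dat E') (GV (tV E v \<one>\<^bsub>R\<^esub>)) (tK E' 1 r)) (act (dat E') (GV (tV E w \<one>\<^bsub>R\<^esub>)) (tK E' 1 s)) =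
          invol (dat E') (tK E' 1 r) * f (GV (tV E v \<one>\<^bsub>R\<^esub>)) (GV (tV E w \<one>\<^bsub>R\<^esub>)) * tK E' 1 s"
          if "f = f' \<or> f = f''" for f
          using sesq that by blast
        then show ?case
          using f'(2) f'' act[of f'] act[of f''] by (simp add: tensor_eq_act[OF \<open>r \<in> _\<close>] tensor_eq_act[OF \<open>s \<in> _\<close>])
      next
        case (add w w')
        have right: "f u (w + w') = f u w + f u w'" if "f = f' \<or> f = f''" for f u
          using sesq that additive.add by blast
        show ?case
          using add right[of f'] right[of f''] by simp
      qed
    next
      case (add u u')
      have left: "f (u + u') w = f u w + f u' w" if "f = f' \<or> f = f''" for f
        using sesq that additive.add[of "\<lambda>v. f v w"] by blast
      show ?case
        using add left[of f'] left[of f''] by simp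
    qed
  qed
qed (use f' in simp)

lemma change_form_psi:
  assumes "X \<in> endos (dat E)"
  shows "change_form R E E' g (psi (dat E) X) = psi (dat E') (change_end R E E' g X)"
  by (rule change_form_eqI[OF tgt.ext.psi_sesquilinear[OF change_end(1)[OF assms] tgt.tensor_facts(7)]])
    (simp add: psi_def change_end(2)[OF assms] GK_form GK_add)

lemma change_form_phi:
  assumes "X \<in> endos (dat E)"
  shows "change_form R E E' g (phi (dat E) X) = phi (dat E') (change_end R E E' g X)"
  by (rule change_form_eqI[OF tgt.ext.phi_sesquilinear[OF change_end(1)[OF assms]]])
    (simp add: phi_def change_end(2)[OF assms] GK_form)

lemma T_tilde_endos: "X \<in> T_tilde D R E \<Longrightarrow> X \<in> endos (dat E)"
  using src.T_tilde_subset_T0 src.ext.T0_endos by blast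

lemma functorial:
  "change_end R E E' g ` T_tilde D R E \<subseteq> T_tilde D S E' \<and>
   change_form R E E' g ` H_tilde D R E \<subseteq> H_tilde D S E' \<and>
   (\<forall>X\<in>T_tilde D R E.
     change_form R E E' g (phi (dat E) X) = phi (dat E') (change_end R E E' g X))"
  using change_end_T_tilde change_form_psi change_form_phi T_tilde_endos
  by (auto simp: H_tilde_def)

end

text \<open>Factoring a morphism through H~ is more than an inclusion of sets for one R: H~(R) has
  to lie in H^0(R), and T~, H~ and the map have to be compatible with homomorphisms of flat
  A-algebras.\<close>

theorem theorem3p15:
  fixes val :: "'f::field \<Rightarrow> int"
    and \<iota> :: "'f \<Rightarrow> 'k::ring_1"
    and n :: nat
    and D :: "('k, 'v::ab_group_add) herm"
    and R :: "('f, 'r) module"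
    and E :: "('k, 'v, 'r, 'kr::{ring,monoid_mult}, 'vr::ab_group_add) extension"
  assumes "hermitian_lattice val \<iota> n D"
    and "flat_algebra val R"
    and "scalar_extension val \<iota> D R E"
  shows "phi (dat E) ` T_tilde D R E \<subseteq> H_tilde D R E \<and>
    H_tilde D R E \<subseteq> H0 (dat E) \<and>
    (\<forall>(S :: ('f, 's) module)
       (E' :: ('k, 'v, 's, 'ks::{ring,monoid_mult}, 'vs::ab_group_add) extension) g.
       flat_algebra val S \<and> scalar_extension val \<iota> D S E' \<and> algebra_hom val R S g \<longrightarrow>
       change_end R E E' g ` T_tilde D R E \<subseteq> T_tilde D S E' \<and>
       change_form R E E' g ` H_tilde D R E \<subseteq> H_tilde D S E' \<and>
       (\<forall>X\<in>T_tilde D R E.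
          change_form R E E' g (phi (dat E) X) = phi (dat E') (change_end R E E' g X)))"
proof -
  interpret herm_lattice val D \<iota> n
    by (rule hermitian_lattice_imp_herm_lattice[OF assms(1)])
  \<comment> \<open>The bases are chosen once, over A, so that R and every S use the same
    ones.\<close>
  obtain e b c where "dual_bases D n e b c"
    using dual_bases_exist by blast
  then have L: "lattice_with_bases val D \<iota> n e b c"
    using herm_lattice_axioms by (simp add: lattice_with_bases_def)
  interpret lattice_with_bases val D \<iota> n e b c
    by (rule L)
  interpret src: scalar_ext val D \<iota> n e b c R E
    using assms by (intro scalar_extI)
  have "change_end R E E' g ` T_tilde D R E \<subseteq> T_tilde D S E' \<and>
      change_form R E E' g ` H_tilde D R E \<subseteq> H_tilde D S E' \<and>
      (\<forall>X\<in>T_tilde D R E.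
        change_form R E E' g (phi (dat E) X) = phi (dat E') (change_end R E E' g X))"
    if "flat_algebra val S \<and> scalar_extension val \<iota> D S E' \<and> algebra_hom val R S g"
    for S :: "('f, 's) module"
      and E' :: "('k, 'v, 's, 'ks::{ring,monoid_mult}, 'vs::ab_group_add) extension" and g
  proof -
    interpret base_change val D \<iota> n e b c R E S E' g
      using that scalar_extI[of S E'] src.scalar_ext_axioms
      by (simp add: base_change_def base_change_axioms_def)
    show ?thesis
      by (rule functorial)
  qed
  then show ?thesis
    using src.phi_T_tilde src.H_tilde_subset_H0 by blast
qed

end
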